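(* Let $G$, $H$ be two finite groups. Then any Hopf algebra morphism $\psi: D(k[G]) \to D(k[H])$ between the Drinfel'd doubles has the form $$\psi ( e_g \# g') = \sum_{x\in G, \; y, z \in H} \lambda (g x^{-1}, z) \, \omega (g', y) \, \theta(?, x)\, \delta_{(?, \, z y z^{-1})} \;\#\; z \, v(g')$$ for all $g, g' \in G$, where $(\lambda, \omega, \theta, v)$ is a quadruple such that $v: G \to H$ is a morphism of groups and $\theta : H\times G \to k$, $\lambda : G\times H \to k$, $\omega : G\times H \to k$ are three maps satisfying the following compatibilities for all $g, g' \in G$, $h, h' \in H$: \begin{align*} &\theta (1, g) = \delta_{g, 1_G}, \qquad \sum_{x\in G} \theta (h, x) = 1, \qquad \theta (h h', g) = \sum_{x\in G} \theta (h, x) \, \theta (h', x^{-1}g),\\ &\omega (1, h) = 1, \qquad \omega(g, h h') = \omega (g, h) \, \omega(g, h'),\\ &\sum_{y\in H} \lambda (g, y) = \delta_{g, 1}, \qquad \sum_{x\in G} \lambda (x, h) = \delta_{1, h},\\ &\sum_{y\in H} \lambda (g, y) \, \lambda (g' , y^{-1} h) = \delta_{g, g'} \, \lambda (g, h),\\ &\sum_{x\in G} \lambda (x, h) \, \lambda (g x^{-1}, h' ) = \delta_{h, h'} \, \lambda (g, h),\\ &\sum_{x\in G} \theta (h, x) \, \lambda (g x^{-1}, h' ) = \sum_{x\in G} \theta (h, x) \, \lambda (x^{-1} g , h' ),\\ &\sum_{x \in G, \, y \in H} \lambda (g x^{-1}, y) \, \theta (h, x) \, \theta (y^{-1}h y,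 g' ) = \delta_{g, g'} \, \theta (h, g),\\ &\omega (g, h) \, \omega \bigl(g' , v(g)^{-1}h v(g) \bigr) = \omega (g g' , h),\\ &\sum_{x\in G, \, y \in H} \theta (h, x g^{-1}) \, \omega (g, y^{-1} h y)\, \lambda (g g' x^{-1}, y) = \omega (g, h) \, \theta \bigl(v(g)^{-1} h v(g), g' \bigr),\\ &\lambda \bigl( g g' g^{-1}, v(g) \, h \, v(g)^{-1} \bigr) = \lambda (g', h). \end{align*} The correspondence $\psi \leftrightarrow (\lambda, \omega, \theta, v)$ between the set of all Hopf algebra morphisms $\psi: D(k[G]) \to D(k[H])$ and the set of all quadruples $(\lambda, \omega, \theta, v)$ satisfying these compatibility conditions is bijective.
   Context: $k$ is a field. For a finite group $G$, let $\{e_g\}_{g \in G} \subset k[G]^*$ be the dual basis of the basis $\{g\}_{g\in G}$ of the group algebra $k[G]$. The Drinfel'd double $D(k[G]) = (k[G]^* )^{\rm cop} \# k[G]$ is the Hopf algebra with $k$-basis $\{e_h \# g\}_{g, h \in G}$ (where $e_h \# g = e_h \otimes g$), multiplication and comultiplication $$(e_h \# g) \cdot (e_x \# y) = \delta_{h,\, g x g^{-1}} \; e_h \# g y, \qquad \Delta(e_h \# g) = \sum_{x \in G} (e_x \# g) \otimes (e_{h x^{-1}} \# g),$$ unit $\sum_{g\in G} e_g \# 1$ and counit $\varepsilon(e_h \# g) = \delta_{h, 1}$. Here $\delta$ is the Kronecker delta. For fixed $x \in G$ and $y, z \in H$, the symbol $\theta(?, x) \, \delta_{(?, \, zyz^{-1})}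 \in k[H]^*$ denotes the $k$-linear map sending any $w \in H$ to $\theta(w, x)\, \delta_{w, \, zyz^{-1}}$. *)

theory Defs
  imports "HOL-Analysis.Analysis"
begin

text \<open>
  A finite group is a type of class \<^class>\<open>group_add\<close> (not assumed commutative) and
  \<^class>\<open>finite\<close>, written additively: \<open>0\<close> is the neutral element, \<open>g - x\<close> stands
  for \<open>g x\<inverse>\<close>, \<open>- x + g\<close> for \<open>x\<inverse> g\<close>, and \<open>g + x - g\<close> for \<open>g x g\<inverse>\<close>.

  A vector space over a field with a basis indexed by a finite type \<open>'i\<close> is the coordinate
  space \<open>'k ^ 'i\<close>, with basis vectors \<open>axis i 1\<close>. The tensor product of \<open>'k ^ 'i\<close> and
  \<open>'k ^ 'j\<close> is \<open>'k ^ ('i \<times> 'j)\<close>, the basis vector \<open>axis (i, j) 1\<close> being the tensor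
  of \<open>axis i 1\<close> and \<open>axis j 1\<close>.
\<close>

section \<open>Hopf algebras with a finite basis\<close>

definition tensor :: "'k::field ^ 'i::finite \<Rightarrow> 'k ^ 'j::finite \<Rightarrow> 'k ^ ('i \<times> 'j)" where
  "tensor a b = (\<chi> p. a $ fst p * b $ snd p)"

text \<open>For bilinear \<open>B\<close>, the linear map sending \<open>tensor a b\<close> to \<open>B a b\<close>.\<close>

definition tensor_lift ::
  "('k ^ 'i \<Rightarrow> 'k ^ 'j \<Rightarrow> 'k ^ 'm) \<Rightarrow> 'k::field ^ ('i::finite \<times> 'j::finite) \<Rightarrow> 'k ^ 'm::finite" where
  "tensor_lift B t = (\<Sum>i\<in>UNIV. \<Sum>j\<in>UNIV. t $ (i, j) *s B (axis i 1) (axis j 1))"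

definition tensor_map ::
  "('k ^ 'i \<Rightarrow> 'k ^ 'm) \<Rightarrow> ('k ^ 'j \<Rightarrow> 'k ^ 'n) \<Rightarrow>
    'k::field ^ ('i::finite \<times> 'j::finite) \<Rightarrow> 'k ^ ('m::finite \<times> 'n::finite)" where
  "tensor_map f g = tensor_lift (\<lambda>a b. tensor (f a) (g b))"

record ('k, 'i) hopf_data =
  hmult :: "'k ^ 'i \<Rightarrow> 'k ^ 'i \<Rightarrow> 'k ^ 'i::finite"
  hunit :: "'k ^ 'i"
  hcomult :: "'k ^ 'i \<Rightarrow> 'k ^ ('i \<times> 'i)"
  hcounit :: "'k ^ 'i \<Rightarrow> 'k"
  hantipode :: "'k ^ 'i \<Rightarrow> 'k ^ 'i"

definition hopf_algebra :: "('k::field, 'i::finite) hopf_data \<Rightarrow> bool" where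
  "hopf_algebra A \<longleftrightarrow>
    (\<forall>a. Vector_Spaces.linear (*s) (*s) (hmult A a)) \<and>
    (\<forall>b. Vector_Spaces.linear (*s) (*s) (\<lambda>a. hmult A a b)) \<and>
    (\<forall>a b c. hmult A (hmult A a b) c = hmult A a (hmult A b c)) \<and>
    (\<forall>a. hmult A (hunit A) a = a \<and> hmult A a (hunit A) = a) \<and>
    Vector_Spaces.linear (*s) (*s) (hcomult A) \<and>
    Vector_Spaces.linear (*s) (*) (hcounit A) \<and>
    (\<forall>a i j l. tensor_map (hcomult A) (\<lambda>x. x) (hcomult A a) $ ((i, j), l) =
               tensor_map (\<lambda>x. x) (hcomult A) (hcomult A a) $ (i, (j, l))) \<and>
    (\<forall>a. tensor_lift (\<lambda>x y. hcounit A x *s y) (hcomult A a) = a) \<and>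
    (\<forall>a. tensor_lift (\<lambda>x y. hcounit A y *s x) (hcomult A a) = a) \<and>
    (\<forall>a b. hcomult A (hmult A a b) =
       tensor_lift (\<lambda>a1 a2. tensor_lift (\<lambda>b1 b2. tensor (hmult A a1 b1) (hmult A a2 b2))
         (hcomult A b)) (hcomult A a)) \<and>
    hcomult A (hunit A) = tensor (hunit A) (hunit A) \<and>
    (\<forall>a b. hcounit A (hmult A a b) = hcounit A a * hcounit A b) \<and>
    hcounit A (hunit A) = 1 \<and>
    Vector_Spaces.linear (*s) (*s) (hantipode A) \<and>
    (\<forall>a. tensor_lift (\<lambda>x y. hmult A (hantipode A x) y) (hcomult A a) = hcounit A a *s hunit A) \<and>
    (\<forall>a. tensor_lift (\<lambda>x y. hmult A x (hantipode A y)) (hcomult A a) = hcounit A a *s hunit A)"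

definition hopf_morphism ::
  "('k::field, 'i::finite) hopf_data \<Rightarrow> ('k, 'j::finite) hopf_data \<Rightarrow> ('k ^ 'i \<Rightarrow> 'k ^ 'j) \<Rightarrow> bool" where
  "hopf_morphism A B \<psi> \<longleftrightarrow>
    Vector_Spaces.linear (*s) (*s) \<psi> \<and>
    (\<forall>a b. \<psi> (hmult A a b) = hmult B (\<psi> a) (\<psi> b)) \<and>
    \<psi> (hunit A) = hunit B \<and>
    (\<forall>a. hcomult B (\<psi> a) = tensor_map \<psi> \<psi> (hcomult A a)) \<and>
    (\<forall>a. hcounit B (\<psi> a) = hcounit A a) \<and>
    (\<forall>a. \<psi> (hantipode A a) = hantipode B (\<psi> a))"


section \<open>The Drinfel'd double of a finite group algebra\<close>

text \<open>
  The index \<open>(h, g)\<close> is that of the basis vector \<open>e\<^sub>h # g\<close>. An element of the dual of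
  \<open>k[G]\<close> is given by its values \<open>\<phi> w\<close> on the basis \<open>G\<close>, so
  \<open>\<phi> # g\<close> is the sum of the \<open>\<phi> w\<close> times \<open>e\<^sub>w # g\<close>.
\<close>

definition dbasis :: "'g::finite \<Rightarrow> 'g \<Rightarrow> 'k::field ^ ('g \<times> 'g)" where
  "dbasis h g = axis (h, g) 1"

definition smash :: "('g::finite \<Rightarrow> 'k::field) \<Rightarrow> 'g \<Rightarrow> 'k ^ ('g \<times> 'g)" where
  "smash \<phi> g = (\<Sum>w\<in>UNIV. \<phi> w *s dbasis w g)"

text \<open>
  The structure maps are the (bi)linear extensions of their values on the basis vectors. The
  antipode is \<open>S (e\<^sub>h # g) = (1 # g\<inverse>) (S e\<^sub>h # 1)\<close>, where \<open>S e\<^sub>h\<close> is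
  \<open>e\<close> indexed by \<open>h\<inverse>\<close>.
\<close>

definition drinfeld_double :: "('k::field, 'g::{group_add,finite} \<times> 'g) hopf_data" where
  "drinfeld_double =
    \<lparr> hmult = (\<lambda>a b. \<Sum>h\<in>UNIV. \<Sum>g\<in>UNIV. \<Sum>x\<in>UNIV. \<Sum>y\<in>UNIV.
        (a $ (h, g) * b $ (x, y)) *s (of_bool (h = g + x - g) *s dbasis h (g + y))),
      hunit = (\<Sum>g\<in>UNIV. dbasis g 0),
      hcomult = (\<lambda>a. \<Sum>h\<in>UNIV. \<Sum>g\<in>UNIV.
        a $ (h, g) *s (\<Sum>x\<in>UNIV. tensor (dbasis x g) (dbasis (h - x) g))),
      hcounit = (\<lambda>a. \<Sum>h\<in>UNIV. \<Sum>g\<in>UNIV. a $ (h, g) * of_bool (h = 0)),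
      hantipode = (\<lambda>a. \<Sum>h\<in>UNIV. \<Sum>g\<in>UNIV. a $ (h, g) *s dbasis (- g - h + g) (- g)) \<rparr>"


lemma sum_of_bool_delta: "(\<Sum>i\<in>UNIV. of_bool (i = (p::'i::finite)) * f i) = (f p :: 'k::field)"
   "(\<Sum>i\<in>UNIV. f i * of_bool (i = (p::'i::finite))) = (f p :: 'k::field)"
  by (simp_all add: of_bool_def if_distrib[where f="\<lambda>c. c * _"] if_distrib[where f="\<lambda>c. _ * c"] cong: if_cong)

lemma sum_of_bool_delta2: "(\<Sum>i\<in>UNIV. \<Sum>j\<in>UNIV. of_bool (i = (p::'i::finite)) * (of_bool (j = (q::'j::finite)) * f i j)) = (f p q :: 'k::field)"
  by (simp only: sum_of_bool_delta sum_distrib_left[symmetric])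

lemma sum_UNIV_prod: "(\<Sum>p\<in>(UNIV::('a::finite\<times>'b::finite) set). f p) = (\<Sum>a\<in>UNIV. \<Sum>b\<in>UNIV. f (a,b))"
  by (simp add: sum.cartesian_product flip: UNIV_Times_UNIV)

lemma dbasis_nth: "dbasis h g $ (x,y) = of_bool (x = h) * of_bool (y = g)"
  by (auto simp: dbasis_def axis_def)

lemma eq_conj_iff: "((h::'g::group_add) = g + x - g) = (x = - g + h + g)"
  by (metis add.assoc add_diff_cancel minus_add_cancel add_minus_cancel diff_add_cancel)

lemma dd_hmult_nth: "hmult (drinfeld_double::('k::field,'g::{group_add,finite}\<times>'g) hopf_data) a b $ (h,k)
   = (\<Sum>g\<in>UNIV. a $ (h,g) * b $ (- g + h + g, - g + k))"
proof -
  have *: "(k = g + y) = (y = - g + k)" for g y :: 'g by (metis add_minus_cancel minus_add_cancel)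
  have "hmult (drinfeld_double::('k::field,'g::{group_add,finite}\<times>'g) hopf_data) a b $ (h,k) = 
    (\<Sum>h'\<in>UNIV. \<Sum>g\<in>UNIV. \<Sum>x\<in>UNIV. \<Sum>y\<in>UNIV. of_bool (h'=h) * (of_bool (x = - g + h' + g) * (of_bool (y = - g + k) * (a $ (h', g) * b $ (x, y)))))"
    unfolding drinfeld_double_def by (simp add: dbasis_nth eq_conj_iff *, (rule sum.cong[OF refl])+, auto)
  also have "\<dots> = (\<Sum>g\<in>UNIV. a $ (h,g) * b $ (- g + h + g, - g + k))"
    by (simp only: sum_of_bool_delta sum_distrib_left[symmetric])
  finally show ?thesis .
qed

lemma dd_hunit_nth: "hunit (drinfeld_double::('k::field,'g::{group_add,finite}\<times>'g) hopf_data) $ (h,k) = of_bool (k = 0)"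
  by (simp add: drinfeld_double_def dbasis_nth of_bool_def if_distrib[where f="\<lambda>c. c * _"] cong: if_cong)

lemma dd_hcounit_eq: "hcounit (drinfeld_double::('k::field,'g::{group_add,finite}\<times>'g) hopf_data) a = (\<Sum>g\<in>UNIV. a $ (0,g))"
  unfolding drinfeld_double_def by (subst hopf_data.simps, subst sum.swap) (simp add: of_bool_def if_distrib[where f="\<lambda>c. _ * c"] cong: if_cong)

lemma dd_hcomult_nth: "hcomult (drinfeld_double::('k::field,'g::{group_add,finite}\<times>'g) hopf_data) a $ ((h,g),(h',g'))
   = of_bool (g' = g) * a $ (h' + h, g)"
proof -
  have "hcomult (drinfeld_double::('k::field,'g::{group_add,finite}\<times>'g) hopf_data) a $ ((h,g),(h',g')) =
   (\<Sum>k\<in>UNIV. \<Sum>l\<in>UNIV. \<Sum>x\<in>UNIV. of_bool (g' = g) * (of_bool (k = h' + h) * (of_bool (l = g) * (of_bool (x = h) * a $ (k,l)))))"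
    unfolding drinfeld_double_def hopf_data.simps sum_component vector_smult_component sum_distrib_left by ((rule sum.cong[OF refl])+, auto simp: dbasis_nth tensor_def)
  also have "\<dots> = of_bool (g' = g) * a $ (h' + h, g)"
    by (simp only: sum_of_bool_delta sum_distrib_left[symmetric])
  finally show ?thesis .
qed

lemma dd_hantipode_nth: "hantipode (drinfeld_double::('k::field,'g::{group_add,finite}\<times>'g) hopf_data) a $ (h,g) = a $ (- g - h + g, - g)"
proof -
  have *: "(g = - l) = (l = - g)" for l :: 'g by auto
  have **: "(h = g - k - g) = (k = - g - h + g)" for k
    using eq_conj_iff[of h g "-k"] by (metis minus_add add.assoc diff_conv_add_uminus minus_minus)
  have "hantipode (drinfeld_double::('k::field,'g::{group_add,finite}\<times>'g) hopf_data) a $ (h,g) =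
    (\<Sum>k\<in>UNIV. \<Sum>l\<in>UNIV. of_bool (k = - g - h + g) * (of_bool (l = - g) * a $ (k,l)))"
    unfolding drinfeld_double_def hopf_data.simps sum_component vector_smult_component by ((rule sum.cong[OF refl])+, auto simp: dbasis_nth * **)
  also have "\<dots> = a $ (- g - h + g, - g)"
    by (simp only: sum_of_bool_delta sum_distrib_left[symmetric])
  finally show ?thesis .
qed

lemma axis_one_nth: "axis i (1::'k::field) $ j = of_bool (j = i)" by (simp add: axis_def)

lemma linear_vecI: "Vector_Spaces.linear (*s) (*s) f" if "\<And>a b. f (a + b) = f a + f b" "\<And>c a. f (c *s a) = c *s f a"
  for f :: "'k::field^'n::finite \<Rightarrow> 'k^'m::finite"
  using that by (intro Vector_Spaces.linear.intro) (auto intro!: module_hom_axioms.intro module_hom.intro vec.vector_space_axioms vec.module_axioms simp: vector_space_def)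

lemma linear_formI: "Vector_Spaces.linear (*s) (*) f" if "\<And>a b. f (a + b) = f a + f b" "\<And>c a. f (c *s a) = c * f a"
  for f :: "'k::field^'n::finite \<Rightarrow> 'k"
  unfolding Vector_Spaces.linear_iff using that
  by (auto simp: vector_space_def algebra_simps intro: vec.vector_space_axioms)

lemma sum_swap3: "(\<Sum>i\<in>I. \<Sum>j\<in>J. \<Sum>m\<in>M. F i j m) = (\<Sum>m\<in>M. \<Sum>i\<in>I. \<Sum>j\<in>J. F i j m)"
proof -
  have "(\<Sum>i\<in>I. \<Sum>j\<in>J. \<Sum>m\<in>M. F i j m) = (\<Sum>i\<in>I. \<Sum>m\<in>M. \<Sum>j\<in>J. F i j m)"
    by (rule sum.cong[OF refl], rule sum.swap)
  also have "\<dots> = (\<Sum>m\<in>M. \<Sum>i\<in>I. \<Sum>j\<in>J. F i j m)" by (rule sum.swap)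
  finally show ?thesis .
qed

lemma tensor_lift_nth: "tensor_lift B t $ r = (\<Sum>m\<in>M. t $ (P m, Q m))"
  if "\<And>x y. B x y $ r = (\<Sum>m\<in>M. x $ P m * y $ Q m)"
  for B :: "'k::field^'i \<Rightarrow> 'k^'j \<Rightarrow> 'k^'m"  and t :: "'k::field ^ ('i::finite \<times> 'j::finite)"
proof -
  have "tensor_lift B t $ r = (\<Sum>i\<in>UNIV. \<Sum>j\<in>UNIV. \<Sum>m\<in>M. of_bool (i = P m) * (of_bool (j = Q m) * t $ (i,j)))"
    unfolding tensor_lift_def sum_component vector_smult_component that sum_distrib_left by ((rule sum.cong[OF refl])+, auto simp: axis_one_nth)
  also have "\<dots> = (\<Sum>m\<in>M. \<Sum>i\<in>UNIV. \<Sum>j\<in>UNIV. of_bool (i = P m) * (of_bool (j = Q m) * t $ (i,j)))"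
    by (rule sum_swap3)
  also have "\<dots> = (\<Sum>m\<in>M. t $ (P m, Q m))" by (simp only: sum_of_bool_delta2)
  finally show ?thesis .
qed

lemma tensor_lift_nth1: "tensor_lift B t $ r = c * t $ (p, q)"
  if "\<And>x y. B x y $ r = c * (x $ p * y $ q)"
  for B :: "'k::field^'i \<Rightarrow> 'k^'j \<Rightarrow> 'k^'m"  and t :: "'k::field ^ ('i::finite \<times> 'j::finite)"
proof -
  have "tensor_lift B t $ r = (\<Sum>i\<in>UNIV. \<Sum>j\<in>UNIV. of_bool (i = p) * (of_bool (j = q) * (c * t $ (i,j))))"
    unfolding tensor_lift_def sum_component vector_smult_component that sum_distrib_left by ((rule sum.cong[OF refl])+, auto simp: axis_one_nth)
  then show ?thesis by (simp only: sum_of_bool_delta2)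
qed

lemma tensor_lift_nthc: "tensor_lift B t $ r = (\<Sum>m\<in>M. c m * t $ (P m, Q m))"
  if "\<And>x y. B x y $ r = (\<Sum>m\<in>M. c m * (x $ P m * y $ Q m))"
  for B :: "'k::field^'i \<Rightarrow> 'k^'j \<Rightarrow> 'k^'m"  and t :: "'k::field ^ ('i::finite \<times> 'j::finite)"
proof -
  have "tensor_lift B t $ r = (\<Sum>i\<in>UNIV. \<Sum>j\<in>UNIV. \<Sum>m\<in>M. of_bool (i = P m) * (of_bool (j = Q m) * (c m * t $ (i,j))))"
    unfolding tensor_lift_def sum_component vector_smult_component that sum_distrib_left
    by ((rule sum.cong[OF refl])+, auto simp: axis_one_nth)
  also have "\<dots> = (\<Sum>m\<in>M. \<Sum>i\<in>UNIV. \<Sum>j\<in>UNIV. of_bool (i = P m) * (of_bool (j = Q m) * (c m * t $ (i,j))))"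
    by (rule sum_swap3)
  also have "\<dots> = (\<Sum>m\<in>M. c m * t $ (P m, Q m))" by (simp only: sum_of_bool_delta2)
  finally show ?thesis .
qed

lemma dd_assoc: fixes a :: "('k::field ^ ('g::{group_add,finite} \<times> 'g))" shows "hmult drinfeld_double (hmult drinfeld_double a b) c = hmult drinfeld_double a (hmult drinfeld_double b c)"
proof (rule vec_eq_iff[THEN iffD2], clarify)
  fix h k :: 'g
  have "hmult drinfeld_double (hmult drinfeld_double a b) c $ (h,k) = (\<Sum>l\<in>UNIV. \<Sum>g\<in>UNIV. a $ (h,g) * b $ (- g + h + g, - g + l) * c $ (- l + h + l, - l + k))"
    by (simp add: dd_hmult_nth sum_distrib_right)
  also have "\<dots> = (\<Sum>g\<in>UNIV. \<Sum>l\<in>UNIV. a $ (h,g) * b $ (- g + h + g, - g + l) * c $ (- l + h + l, - l + k))"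
    by (rule sum.swap)
  also have "\<dots> = (\<Sum>g\<in>UNIV. \<Sum>l\<in>UNIV. a $ (h,g) * b $ (- g + h + g, l) * c $ (- (g + l) + h + (g + l), - (g + l) + k))"
    proof (rule sum.cong[OF refl])
    fix g
    show "(\<Sum>l\<in>UNIV. a $ (h,g) * b $ (- g + h + g, - g + l) * c $ (- l + h + l, - l + k)) =
      (\<Sum>l\<in>UNIV. a $ (h,g) * b $ (- g + h + g, l) * c $ (- (g + l) + h + (g + l), - (g + l) + k))"
      by (rule sum.reindex_bij_witness[where i="\<lambda>l. g + l" and j="\<lambda>l. - g + l"]) (auto simp: add.assoc[symmetric])
  qed
  also have "\<dots> = hmult drinfeld_double a (hmult drinfeld_double b c) $ (h,k)"
    by (simp add: dd_hmult_nth sum_distrib_left minus_add add.assoc mult.assoc diff_conv_add_uminus del: add_uminus_conv_diff)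
  finally show "hmult drinfeld_double (hmult drinfeld_double a b) c $ (h,k) = hmult drinfeld_double a (hmult drinfeld_double b c) $ (h,k)" .
qed

lemma minus_add_eq_0: "(- g + k = 0) = (g = (k::'g::group_add))" by (metis add_minus_cancel left_minus minus_add_cancel add_0_right)

lemma dd_unit: fixes a :: "('k::field ^ ('g::{group_add,finite} \<times> 'g))" shows "hmult drinfeld_double (hunit drinfeld_double) a = a" "hmult drinfeld_double a (hunit drinfeld_double) = a"
  by (simp_all add: vec_eq_iff dd_hmult_nth dd_hunit_nth sum_of_bool_delta minus_add_eq_0)

lemma dd_coassoc: fixes a :: "('k::field ^ ('g::{group_add,finite} \<times> 'g))" shows "tensor_map (hcomult drinfeld_double) (\<lambda>x. x) (hcomult drinfeld_double a) $ ((i, j), l) =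
               tensor_map (\<lambda>x. x) (hcomult drinfeld_double) (hcomult drinfeld_double a) $ (i, (j, l))"
proof -
  obtain i1 i2 j1 j2 l1 l2 where [simp]: "i = (i1,i2)" "j = (j1,j2)" "l=(l1,l2)" by (metis surj_pair)
  have "tensor_map (hcomult drinfeld_double) (\<lambda>x. x) t $ ((i, j), l) = of_bool (j2 = i2) * t $ ((j1 + i1, i2), l)" for t :: "'k ^ (('g \<times> 'g) \<times> ('g \<times> 'g))"
    unfolding tensor_map_def by (rule tensor_lift_nth1) (simp add: tensor_def dd_hcomult_nth)
  moreover have "tensor_map (\<lambda>x. x) (hcomult drinfeld_double) t $ (i, (j, l)) = of_bool (l2 = j2) * t $ (i, (l1 + j1, j2))" for t :: "'k ^ (('g \<times> 'g) \<times> ('g \<times> 'g))"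
    unfolding tensor_map_def by (rule tensor_lift_nth1) (simp add: tensor_def dd_hcomult_nth)
  ultimately show ?thesis by (auto simp: dd_hcomult_nth add.assoc)
qed

lemma dd_counitl: fixes a :: "('k::field ^ ('g::{group_add,finite} \<times> 'g))" shows "tensor_lift (\<lambda>x y. hcounit drinfeld_double x *s y) (hcomult drinfeld_double a) = a"
proof (rule vec_eq_iff[THEN iffD2], clarify)
  fix h k :: 'g
  have "tensor_lift (\<lambda>x y. hcounit drinfeld_double x *s y) t $ (h,k) = (\<Sum>g\<in>UNIV. t $ ((0,g),(h,k)))" for t :: "'k ^ (('g \<times> 'g) \<times> ('g \<times> 'g))"
    by (rule tensor_lift_nth) (simp add: dd_hcounit_eq sum_distrib_right)
  then show "tensor_lift (\<lambda>x y. hcounit drinfeld_double x *s y) (hcomult drinfeld_double a) $ (h,k) = a $ (h,k)"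
    by (simp add: dd_hcomult_nth sum_of_bool_delta eq_commute[of k])
qed

lemma dd_counitr: fixes a :: "('k::field ^ ('g::{group_add,finite} \<times> 'g))" shows "tensor_lift (\<lambda>x y. hcounit drinfeld_double y *s x) (hcomult drinfeld_double a) = a"
proof (rule vec_eq_iff[THEN iffD2], clarify)
  fix h k :: 'g
  have "tensor_lift (\<lambda>x y. hcounit drinfeld_double y *s x) t $ (h,k) = (\<Sum>g\<in>UNIV. t $ ((h,k),(0,g)))" for t :: "'k ^ (('g \<times> 'g) \<times> ('g \<times> 'g))"
    by (rule tensor_lift_nth) (simp add: dd_hcounit_eq sum_distrib_left mult.commute)
  then show "tensor_lift (\<lambda>x y. hcounit drinfeld_double y *s x) (hcomult drinfeld_double a) $ (h,k) = a $ (h,k)"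
    by (simp add: dd_hcomult_nth sum_of_bool_delta)
qed

lemma dd_antl: fixes a :: "('k::field ^ ('g::{group_add,finite} \<times> 'g))" shows "tensor_lift (\<lambda>x y. hmult drinfeld_double (hantipode drinfeld_double x) y) (hcomult drinfeld_double a) = hcounit drinfeld_double a *s hunit drinfeld_double"
proof (rule vec_eq_iff[THEN iffD2], clarify)
  fix h k :: 'g
  have *: "tensor_lift (\<lambda>x y. hmult drinfeld_double (hantipode drinfeld_double x) y) t $ (h,k) = (\<Sum>g\<in>UNIV. t $ ((-g-h+g,-g),(-g+h+g,-g+k)))" for t :: "'k ^ (('g \<times> 'g) \<times> ('g \<times> 'g))"
    by (rule tensor_lift_nth) (simp add: dd_hmult_nth dd_hantipode_nth)
  have **: "(-g+h+g) + (-g-h+g) = (0::'g)" for g by (simp add: add.assoc diff_conv_add_uminus del: add_uminus_conv_diff)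
  have ***: "(- g + k = - g) = (k = 0)" for g by (metis add_0_right add_left_cancel)
  have "(\<Sum>g\<in>UNIV. a $ (0, - g)) = (\<Sum>g\<in>UNIV. a $ (0, g))"
    by (rule sum.reindex_bij_witness[where i=uminus and j=uminus]) auto
  then show "tensor_lift (\<lambda>x y. hmult drinfeld_double (hantipode drinfeld_double x) y) (hcomult drinfeld_double a) $ (h,k) = (hcounit drinfeld_double a *s hunit drinfeld_double) $ (h,k)"
    unfolding * by (simp add: dd_hcomult_nth ** *** dd_hcounit_eq dd_hunit_nth sum_distrib_right flip: sum_distrib_left)
qed

lemma dd_antr: fixes a :: "('k::field ^ ('g::{group_add,finite} \<times> 'g))" shows "tensor_lift (\<lambda>x y. hmult drinfeld_double x (hantipode drinfeld_double y)) (hcomult drinfeld_double a) = hcounit drinfeld_double a *s hunit drinfeld_double"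
proof (rule vec_eq_iff[THEN iffD2], clarify)
  fix h k :: 'g
  have e: "- (- g + k) - (- g + h + g) + (- g + k) = - k - h + k" for g by (simp add: add.assoc minus_add diff_conv_add_uminus del: add_uminus_conv_diff)
  have *: "tensor_lift (\<lambda>x y. hmult drinfeld_double x (hantipode drinfeld_double y)) t $ (h,k) = (\<Sum>g\<in>UNIV. t $ ((h,g),(-k-h+k,-(-g+k))))" for t :: "'k ^ (('g \<times> 'g) \<times> ('g \<times> 'g))"
    by (rule tensor_lift_nth) (simp only: dd_hmult_nth dd_hantipode_nth e)
  have **: "(- (- g + k) = g) = (k = 0)" for g by (metis add.inverse_inverse add_0_right add_left_cancel)
  show "tensor_lift (\<lambda>x y. hmult drinfeld_double x (hantipode drinfeld_double y)) (hcomult drinfeld_double a) $ (h,k) = (hcounit drinfeld_double a *s hunit drinfeld_double) $ (h,k)"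
    unfolding * by (simp only: dd_hcomult_nth **) (simp add: dd_hcounit_eq dd_hunit_nth sum_distrib_right flip: sum_distrib_left)
qed

lemma dd_comult_mult: fixes a :: "('k::field ^ ('g::{group_add,finite} \<times> 'g))" shows "hcomult drinfeld_double (hmult drinfeld_double a b) =
       tensor_lift (\<lambda>a1 a2. tensor_lift (\<lambda>b1 b2. tensor (hmult drinfeld_double a1 b1) (hmult drinfeld_double a2 b2))
         (hcomult drinfeld_double b)) (hcomult drinfeld_double a)"
proof (rule vec_eq_iff[THEN iffD2], clarify)
  fix h k h' k' :: 'g
  have 1: "tensor_lift (\<lambda>b1 b2. tensor (hmult drinfeld_double a1 b1) (hmult drinfeld_double a2 b2)) t $ ((h,k),(h',k')) =
     (\<Sum>p\<in>UNIV. (a1 $ (h, fst p) * a2 $ (h', snd p)) * t $ ((- fst p + h + fst p, - fst p + k), (- snd p + h' + snd p, - snd p + k')))" for a1 a2 :: "'k ^ ('g \<times> 'g)" and t :: "'k ^ (('g \<times> 'g) \<times> ('g \<times> 'g))"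
    by (rule tensor_lift_nthc) (simp add: tensor_def dd_hmult_nth sum_product sum_UNIV_prod mult_ac)
  have 2: "tensor_lift (\<lambda>a1 a2. tensor_lift (\<lambda>b1 b2. tensor (hmult drinfeld_double a1 b1) (hmult drinfeld_double a2 b2)) t) s $ ((h,k),(h',k')) =
     (\<Sum>p\<in>UNIV. t $ ((- fst p + h + fst p, - fst p + k), (- snd p + h' + snd p, - snd p + k')) * s $ ((h, fst p),(h', snd p)))" for t s :: "'k ^ (('g \<times> 'g) \<times> ('g \<times> 'g))"
    by (rule tensor_lift_nthc) (simp add: 1 mult_ac)
  have g: "- g + h' + g + (- g + h + g) = - g + (h' + h) + g" for g by (simp add: add.assoc)
  show "hcomult drinfeld_double (hmult drinfeld_double a b) $ ((h,k),(h',k')) = tensor_lift (\<lambda>a1 a2. tensor_lift (\<lambda>b1 b2. tensor (hmult drinfeld_double a1 b1) (hmult drinfeld_double a2 b2))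
         (hcomult drinfeld_double b)) (hcomult drinfeld_double a) $ ((h,k),(h',k'))"
  proof -
    have "(\<Sum>p\<in>UNIV. hcomult drinfeld_double b $ ((- fst p + h + fst p, - fst p + k), (- snd p + h' + snd p, - snd p + k')) * hcomult drinfeld_double a $ ((h, fst p),(h', snd p)))
      = (\<Sum>x\<in>UNIV. \<Sum>y\<in>UNIV. of_bool (y = x) * (of_bool (k' = k) * (a $ (h' + h, x) * b $ (- x + (h' + h) + x, - x + k))))"
      unfolding sum_UNIV_prod dd_hcomult_nth fst_conv snd_conv
      by ((rule sum.cong[OF refl])+, auto simp: g)
    also have "\<dots> = hcomult drinfeld_double (hmult drinfeld_double a b) $ ((h,k),(h',k'))"
      by (simp only: sum_of_bool_delta dd_hcomult_nth dd_hmult_nth sum_distrib_left)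
    finally show ?thesis unfolding 2 by simp
  qed
qed

lemma hopf_algebra_drinfeld_double: "hopf_algebra (drinfeld_double::('k::field,'g::{group_add,finite}\<times>'g) hopf_data)"
  unfolding hopf_algebra_def
  apply (intro conjI allI dd_assoc dd_unit dd_counitl dd_counitr dd_antl dd_antr dd_comult_mult)
  apply ((rule linear_vecI linear_formI; simp add: vec_eq_iff dd_hmult_nth dd_hcomult_nth dd_hcounit_eq dd_hantipode_nth algebra_simps sum.distrib sum_distrib_left)+)?
  subgoal by (rule dd_coassoc)
  subgoal by (auto simp: vec_eq_iff dd_hcomult_nth dd_hunit_nth tensor_def)
  subgoal
    apply (simp add: dd_hcounit_eq dd_hmult_nth sum_product)
    apply (subst sum.swap)
    apply (rule sum.cong[OF refl])
    subgoal for x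
      by (rule sum.reindex_bij_witness[where i="\<lambda>l. x + l" and j="\<lambda>l. - x + l"]) (auto simp: add.assoc[symmetric])
    done
  subgoal by (simp add: dd_hcounit_eq dd_hunit_nth)
  subgoal by (rule linear_vecI; simp add: vec_eq_iff dd_hantipode_nth)
  done


section \<open>The quadruples and the associated maps\<close>

definition compatible_quadruple ::
  "('g::{group_add,finite} \<Rightarrow> 'h::{group_add,finite} \<Rightarrow> 'k::field) \<Rightarrow> ('g \<Rightarrow> 'h \<Rightarrow> 'k) \<Rightarrow>
    ('h \<Rightarrow> 'g \<Rightarrow> 'k) \<Rightarrow> ('g \<Rightarrow> 'h) \<Rightarrow> bool" where
  "compatible_quadruple lam \<omega> \<theta> v \<longleftrightarrow>
    (\<forall>g g'. v (g + g') = v g + v g') \<and>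
    (\<forall>g. \<theta> 0 g = of_bool (g = 0)) \<and>
    (\<forall>h. (\<Sum>x\<in>UNIV. \<theta> h x) = 1) \<and>
    (\<forall>h h' g. \<theta> (h + h') g = (\<Sum>x\<in>UNIV. \<theta> h x * \<theta> h' (- x + g))) \<and>
    (\<forall>h. \<omega> 0 h = 1) \<and>
    (\<forall>g h h'. \<omega> g (h + h') = \<omega> g h * \<omega> g h') \<and>
    (\<forall>g. (\<Sum>y\<in>UNIV. lam g y) = of_bool (g = 0)) \<and>
    (\<forall>h. (\<Sum>x\<in>UNIV. lam x h) = of_bool (0 = h)) \<and>
    (\<forall>g g' h. (\<Sum>y\<in>UNIV. lam g y * lam g' (- y + h)) = of_bool (g = g') * lam g h) \<and>
    (\<forall>g h h'. (\<Sum>x\<in>UNIV. lam x h * lam (g - x) h') = of_bool (h = h') * lam g h) \<and>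
    (\<forall>g h h'. (\<Sum>x\<in>UNIV. \<theta> h x * lam (g - x) h') = (\<Sum>x\<in>UNIV. \<theta> h x * lam (- x + g) h')) \<and>
    (\<forall>g g' h. (\<Sum>x\<in>UNIV. \<Sum>y\<in>UNIV. lam (g - x) y * \<theta> h x * \<theta> (- y + h + y) g') =
       of_bool (g = g') * \<theta> h g) \<and>
    (\<forall>g g' h. \<omega> g h * \<omega> g' (- v g + h + v g) = \<omega> (g + g') h) \<and>
    (\<forall>g g' h. (\<Sum>x\<in>UNIV. \<Sum>y\<in>UNIV. \<theta> h (x - g) * \<omega> g (- y + h + y) * lam (g + g' - x) y) =
       \<omega> g h * \<theta> (- v g + h + v g) g') \<and>
    (\<forall>g g' h. lam (g + g' - g) (v g + h - v g) = lam g' h)"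

text \<open>The linear extension of the values of \<open>\<psi>\<close> on the basis vectors \<open>e\<^sub>g # g'\<close>.\<close>

definition psi_of ::
  "('g::{group_add,finite} \<Rightarrow> 'h::{group_add,finite} \<Rightarrow> 'k::field) \<Rightarrow> ('g \<Rightarrow> 'h \<Rightarrow> 'k) \<Rightarrow>
    ('h \<Rightarrow> 'g \<Rightarrow> 'k) \<Rightarrow> ('g \<Rightarrow> 'h) \<Rightarrow> 'k ^ ('g \<times> 'g) \<Rightarrow> 'k ^ ('h \<times> 'h)" where
  "psi_of lam \<omega> \<theta> v a =
    (\<Sum>g\<in>UNIV. \<Sum>g'\<in>UNIV. a $ (g, g') *s
      (\<Sum>x\<in>UNIV. \<Sum>y\<in>UNIV. \<Sum>z\<in>UNIV.
        (lam (g - x) z * \<omega> g' y) *s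
          smash (\<lambda>w. \<theta> w x * of_bool (w = z + y - z)) (z + v g')))"

end

theory Submission
  imports Defs
begin

text \<open>
  The algebra \<open>D(k[G])\<close> is generated by the elements \<open>e\<^sub>g # 0\<close>, which span the dual of
  \<open>k[G]\<close>, and by the group-like elements \<open>1 # s\<close>. A linear map out of \<open>D(k[G])\<close> is a
  Hopf algebra morphism exactly when the images \<open>a g\<close> and \<open>K s\<close> of these generators satisfy the
  relations collected in \<open>double_relations\<close> and \<open>e\<^sub>g # s\<close> is sent to the product of \<open>a g\<close> and
  \<open>K s\<close> (\<open>morphism_double_relations\<close>, \<open>double_relations_morphism\<close>). Compatibility with the
  antipode comes for free, because both composites of a bialgebra map with the antipodes are its
  convolution inverse (\<open>bialgebra_map_antipode\<close>).

  It remains to parametrise the solutions of these relations in \<open>D(k[H])\<close>. The element \<open>K s\<close>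
  is group-like, hence of the form \<open>\<omega> s # v s\<close> with \<open>\<omega> s\<close> multiplicative
  (\<open>grouplike_smash\<close>). As a coalgebra, \<open>D(k[H])\<close> is the tensor product of the dual of
  \<open>k[H]\<close>, with opposite comultiplication, and of \<open>k[H]\<close>, so a coalgebra map into it is the
  convolution product of its two components. The components of \<open>a\<close> are
  \<open>\<theta> w g = (\<Sum>z. a g (w, z))\<close>, obtained from the counit of \<open>k[H]\<close>, and \<open>lam g z = a g (0, z)\<close>,
  obtained from the counit of the dual. They give \<open>a g (w, z) = (\<Sum>x. \<theta> w x * lam (g - x) z)\<close>,
  which is \<open>dual_image\<close>.

  Taking components turns each relation into a compatibility condition
  (\<open>double_relations_quadruple\<close>). Conversely, two coalgebra maps into the double agree once
  their components do, which is why the conditions, although they look weaker, imply the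
  relations (\<open>compatible_double_relations\<close>). In coordinates this principle is the identity
  called \<open>split\<close> in that proof. Since the components are determined by the morphism, the
  quadruple is unique (\<open>psi_of_inject\<close>).
\<close>

section \<open>Linear maps and tensors in coordinates\<close>

text \<open>
  As rewrite rules these bring words in a non-commutative additive group to a right-nested normal
  form without binary minus.
\<close>

lemmas group_word_simps = diff_conv_add_uminus minus_add add.assoc

lemma linear_axis_sum:
  fixes f :: "'k::field ^ 'i::finite \<Rightarrow> 'k ^ 'j::finite"
  assumes "Vector_Spaces.linear (*s) (*s) f"
  shows "f a = (\<Sum>i\<in>UNIV. a $ i *s f (axis i 1))"
proof -
  interpret Vector_Spaces.linear "(*s)" "(*s)" f by (rule assms)
  have "f a = f (\<Sum>i\<in>UNIV. a $ i *s axis i 1)"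
    by (simp only: basis_expansion)
  then show ?thesis by (simp add: sum scale)
qed

lemma linear_compose:
  "Vector_Spaces.linear (*s) (*s) f \<Longrightarrow> Vector_Spaces.linear (*s) (*s) g \<Longrightarrow>
    Vector_Spaces.linear (*s) (*s) (\<lambda>x. g (f x))"
  for f :: "'k::field ^ 'i::finite \<Rightarrow> 'k ^ 'j::finite" and g :: "'k ^ 'j \<Rightarrow> 'k ^ 'l::finite"
  unfolding Vector_Spaces.linear_iff by auto

lemma tensor_lift_tensor:
  fixes B :: "'k::field ^ 'i::finite \<Rightarrow> 'k ^ 'j::finite \<Rightarrow> 'k ^ 'm::finite"
  assumes "\<And>a. Vector_Spaces.linear (*s) (*s) (B a)"
    and "\<And>b. Vector_Spaces.linear (*s) (*s) (\<lambda>a. B a b)"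
  shows "tensor_lift B (tensor a b) = B a b"
proof -
  have "B a b = (\<Sum>i\<in>UNIV. a $ i *s B (axis i 1) b)"
    by (rule linear_axis_sum[OF assms(2)])
  also have "\<dots> = (\<Sum>i\<in>UNIV. a $ i *s (\<Sum>j\<in>UNIV. b $ j *s B (axis i 1) (axis j 1)))"
    by (subst linear_axis_sum[OF assms(1), of _ b]) (rule refl)
  also have "\<dots> = tensor_lift B (tensor a b)"
    by (simp add: tensor_lift_def tensor_def vec.scale_sum_right)
  finally show ?thesis by simp
qed

lemma tensor_lift_sum:
  "tensor_lift B (\<Sum>i\<in>I. t i) = (\<Sum>i\<in>I. tensor_lift B (t i))"
  by (simp add: tensor_lift_def vec.scale_sum_left sum.swap[of _ I])

lemma tensor_lift_add: "tensor_lift B (s + t) = tensor_lift B s + tensor_lift B t"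
  and tensor_lift_scale: "tensor_lift B (c *s t) = c *s tensor_lift B t"
  by (simp_all add: tensor_lift_def vec.scale_sum_right sum.distrib vec.scale_left_distrib)

lemma tensor_map_tensor:
  assumes "Vector_Spaces.linear (*s) (*s) f" "Vector_Spaces.linear (*s) (*s) g"
  shows "tensor_map f g (tensor a b) = tensor (f a) (g b)"
proof -
  interpret f: Vector_Spaces.linear "(*s)" "(*s)" f by (rule assms)
  interpret g: Vector_Spaces.linear "(*s)" "(*s)" g by (rule assms)
  show ?thesis unfolding tensor_map_def
    by (rule tensor_lift_tensor; rule linear_vecI)
       (simp_all add: f.add f.scale g.add g.scale tensor_def vec_eq_iff algebra_simps)
qed

lemma tensor_map_sum_tensor:
  assumes "Vector_Spaces.linear (*s) (*s) f" "Vector_Spaces.linear (*s) (*s) g"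
  shows "tensor_map f g (\<Sum>i\<in>I. tensor (p i) (q i)) = (\<Sum>i\<in>I. tensor (f (p i)) (g (q i)))"
  using tensor_map_tensor[OF assms] by (simp add: tensor_map_def tensor_lift_sum)

section \<open>Morphisms out of a double in terms of generators\<close>

abbreviation dmult (infixl "\<odot>" 70) where "a \<odot> b \<equiv> hmult drinfeld_double a b"
abbreviation dunit ("\<one>") where "\<one> \<equiv> hunit drinfeld_double"
abbreviation dcomult ("\<Delta>") where "\<Delta> \<equiv> hcomult drinfeld_double"
abbreviation dcounit ("\<epsilon>") where "\<epsilon> \<equiv> hcounit drinfeld_double"
abbreviation dantipode ("\<S>") where "\<S> \<equiv> hantipode drinfeld_double"

lemma linear_dmult: "Vector_Spaces.linear (*s) (*s) ((\<odot>) a)" "Vector_Spaces.linear (*s) (*s) (\<lambda>a. a \<odot> b)"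
  and linear_dcomult: "Vector_Spaces.linear (*s) (*s) \<Delta>"
  and linear_dcounit: "Vector_Spaces.linear (*s) (*) \<epsilon>"
  and linear_dantipode: "Vector_Spaces.linear (*s) (*s) \<S>"
  using hopf_algebra_drinfeld_double unfolding hopf_algebra_def by blast+

lemma dmult_sum_left: "(\<Sum>i\<in>I. f i) \<odot> b = (\<Sum>i\<in>I. f i \<odot> b)"
  and dmult_sum_right: "a \<odot> (\<Sum>i\<in>I. f i) = (\<Sum>i\<in>I. a \<odot> f i)"
  and dmult_scale_left: "(c *s a) \<odot> b = c *s (a \<odot> b)"
  and dmult_scale_right: "a \<odot> (c *s b) = c *s (a \<odot> b)"
proof -
  interpret l: Vector_Spaces.linear "(*s)" "(*s)" "\<lambda>a. a \<odot> b" by (rule linear_dmult)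
  interpret r: Vector_Spaces.linear "(*s)" "(*s)" "(\<odot>) a" by (rule linear_dmult)
  show "(\<Sum>i\<in>I. f i) \<odot> b = (\<Sum>i\<in>I. f i \<odot> b)" "a \<odot> (\<Sum>i\<in>I. f i) = (\<Sum>i\<in>I. a \<odot> f i)"
    "(c *s a) \<odot> b = c *s (a \<odot> b)" "a \<odot> (c *s b) = c *s (a \<odot> b)"
    by (simp_all add: l.sum r.sum l.scale r.scale)
qed

lemma dbasis_mult:
  "dbasis h g \<odot> dbasis x y = of_bool (h = g + x - g) *s dbasis h (g + y)"
  by (auto simp: vec_eq_iff dd_hmult_nth dbasis_nth eq_conj_iff sum_of_bool_delta mult.assoc
      sum_distrib_left[symmetric])

lemma dcomult_dbasis:
  fixes h g :: "'g::{group_add,finite}"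
  shows "\<Delta> (dbasis h g) = (\<Sum>x\<in>UNIV. tensor (dbasis x g) (dbasis (h - x) g) :: 'k::field ^ _)"
proof (rule vec_eq_iff[THEN iffD2], clarify)
  fix w u w' u' :: 'g
  have "(w' + w = h) = (w' = h - w)"
    by (metis add_diff_cancel diff_add_cancel)
  moreover have "(\<Sum>x\<in>UNIV. tensor (dbasis x g) (dbasis (h - x) g)) $ ((w, u), (w', u')) =
      (\<Sum>x\<in>UNIV. of_bool (x = w) * (of_bool (u = g) * (of_bool (w' = h - x) * of_bool (u' = g)) :: 'k))"
    by (auto simp: sum_component tensor_def dbasis_nth intro!: sum.cong)
  ultimately show "\<Delta> (dbasis h g) $ ((w, u), (w', u')) =
      ((\<Sum>x\<in>UNIV. tensor (dbasis x g) (dbasis (h - x) g)) $ ((w, u), (w', u')) :: 'k)"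
    by (auto simp: dd_hcomult_nth dbasis_nth sum_of_bool_delta)
qed

lemma dcounit_dbasis: "\<epsilon> (dbasis h g) = of_bool (h = 0)"
  by (auto simp: dd_hcounit_eq dbasis_nth sum_distrib_left[symmetric])

text \<open>
  The relations between the generators \<open>e\<^sub>g # 0\<close> and \<open>1 # s\<close> of \<open>D(k[G])\<close>, for arbitrary
  families \<open>a\<close> and \<open>K\<close> in their place. The last one is the commutation rule that encodes the
  conjugation action of the group on the dual of its group algebra.
\<close>

definition double_relations ::
  "('g::{group_add,finite} \<Rightarrow> 'k::field ^ ('h::{group_add,finite} \<times> 'h)) \<Rightarrow>
    ('g \<Rightarrow> 'k ^ ('h \<times> 'h)) \<Rightarrow> bool" where
  "double_relations a K \<longleftrightarrow>
    (\<forall>g. \<Delta> (a g) = (\<Sum>x\<in>UNIV. tensor (a x) (a (g - x)))) \<and>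
    (\<forall>g. \<epsilon> (a g) = of_bool (g = 0)) \<and>
    (\<forall>g g'. a g \<odot> a g' = of_bool (g = g') *s a g) \<and>
    (\<Sum>g\<in>UNIV. a g) = \<one> \<and>
    (\<forall>s. \<Delta> (K s) = tensor (K s) (K s)) \<and>
    (\<forall>s. \<epsilon> (K s) = 1) \<and>
    K 0 = \<one> \<and>
    (\<forall>s t. K s \<odot> K t = K (s + t)) \<and>
    (\<forall>s g. K s \<odot> a g = a (s + g - s) \<odot> K s)"

lemma smash_nth: "smash \<phi> g $ (w, u) = of_bool (u = g) * \<phi> w"
proof -
  have "smash \<phi> g $ (w, u) = (\<Sum>x\<in>UNIV. of_bool (x = w) * (of_bool (u = g) * \<phi> x))"
    by (auto simp: smash_def dbasis_nth intro!: sum.cong)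
  then show ?thesis by (simp only: sum_of_bool_delta)
qed

text \<open>
  A factor supported on the single group element \<open>v\<close> collapses the sum defining the product to
  one term.
\<close>

lemma dmult_smash_nth:
  fixes w u v :: "'g::{group_add,finite}" and a :: "'k::field ^ ('g \<times> 'g)"
  shows "(a \<odot> smash \<phi> v) $ (w, u) = a $ (w, u - v) * \<phi> (- (u - v) + w + (u - v))"
    and "(smash \<phi> v \<odot> a) $ (w, u) = \<phi> w * a $ (- v + w + v, - v + u)"
proof -
  have *: "(- g + u = v) = (g = u - v)" for g
    by (metis add_minus_cancel diff_add_cancel minus_add_cancel add_diff_cancel)
  show "(a \<odot> smash \<phi> v) $ (w, u) = a $ (w, u - v) * \<phi> (- (u - v) + w + (u - v))"
    by (simp only: dd_hmult_nth smash_nth * mult.left_commute[of "a $ _"] sum_of_bool_delta)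
  show "(smash \<phi> v \<odot> a) $ (w, u) = \<phi> w * a $ (- v + w + v, - v + u)"
    by (simp add: dd_hmult_nth smash_nth mult.assoc sum_of_bool_delta)
qed

lemma dbasis_factor:
  fixes g s :: "'g::{group_add,finite}"
  shows "dbasis g 0 \<odot> smash (\<lambda>_. 1) s = (dbasis g s :: 'k::field ^ _)"
  by (simp add: vec_eq_iff dmult_smash_nth dbasis_nth)

lemma double_relations_dbasis:
  "double_relations (\<lambda>g::'g::{group_add,finite}. dbasis g 0 :: 'k::field ^ _) (smash (\<lambda>_. 1))"
  unfolding double_relations_def
proof (intro conjI allI)
  show "(\<Sum>g\<in>UNIV. dbasis (g::'g) 0) = (\<one> :: 'k ^ _)" by (simp add: drinfeld_double_def)
next
  show "smash (\<lambda>_. 1) 0 = (\<one> :: 'k ^ ('g \<times> 'g))" by (simp add: drinfeld_double_def smash_def)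
next
  fix s :: 'g
  show "\<Delta> (smash (\<lambda>_. 1) s) = tensor (smash (\<lambda>_. 1) s) (smash (\<lambda>_. 1) s :: 'k ^ _)"
    by (auto simp: vec_eq_iff dd_hcomult_nth smash_nth tensor_def)
  show "\<epsilon> (smash (\<lambda>_. 1) s) = (1 :: 'k)"
    by (simp add: dd_hcounit_eq smash_nth)
next
  fix g g' :: 'g
  show "dbasis g 0 \<odot> dbasis g' 0 = of_bool (g = g') *s (dbasis g 0 :: 'k ^ _)"
    by (simp add: dbasis_mult)
next
  fix s t :: 'g
  show "smash (\<lambda>_. 1) s \<odot> smash (\<lambda>_. 1) t = (smash (\<lambda>_. 1) (s + t) :: 'k ^ ('g \<times> 'g))"
    by (auto simp: vec_eq_iff dmult_smash_nth smash_nth diff_eq_eq)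
next
  fix s g :: 'g
  have "(- s + w + s = g) = (w = s + g - s)" for w
    by (metis eq_conj_iff)
  moreover have "(- s + u = 0) = (u = s)" for u :: 'g
    by (metis minus_add_eq_0)
  ultimately show "smash (\<lambda>_. 1) s \<odot> dbasis g 0 =
      dbasis (s + g - s) 0 \<odot> (smash (\<lambda>_. 1) s :: 'k ^ ('g \<times> 'g))"
    unfolding dbasis_factor by (simp add: vec_eq_iff dmult_smash_nth dbasis_nth)
qed (simp_all add: dcomult_dbasis dcounit_dbasis)

lemma morphism_double_relations:
  fixes \<psi> :: "'k::field ^ ('g::{group_add,finite} \<times> 'g) \<Rightarrow> 'k ^ ('h::{group_add,finite} \<times> 'h)"
  assumes "hopf_morphism drinfeld_double drinfeld_double \<psi>"
  defines "a \<equiv> \<lambda>g. \<psi> (dbasis g 0)" and "K \<equiv> \<lambda>s. \<psi> (smash (\<lambda>_. 1) s)"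
  shows "double_relations a K" and "\<psi> (dbasis g s) = a g \<odot> K s"
proof -
  have lin: "Vector_Spaces.linear (*s) (*s) \<psi>"
    and mult: "\<And>x y. \<psi> (x \<odot> y) = \<psi> x \<odot> \<psi> y" and one: "\<psi> \<one> = \<one>"
    and comult: "\<And>x. \<Delta> (\<psi> x) = tensor_map \<psi> \<psi> (\<Delta> x)" and counit: "\<And>x. \<epsilon> (\<psi> x) = \<epsilon> x"
    using assms(1) unfolding hopf_morphism_def by blast+
  interpret Vector_Spaces.linear "(*s)" "(*s)" \<psi> by (rule lin)
  note tms = tensor_map_sum_tensor[OF lin lin]
    and tm = tensor_map_tensor[OF lin lin]
  let ?K = "\<lambda>s::'g. smash (\<lambda>_. 1) s :: 'k ^ ('g \<times> 'g)"
  have rel: "\<And>g::'g. \<Delta> (dbasis g 0) = (\<Sum>x\<in>UNIV. tensor (dbasis x 0 :: 'k ^ ('g \<times> 'g)) (dbasis (g - x) 0))"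
    "\<And>g::'g. \<epsilon> (dbasis g 0) = (of_bool (g = 0) :: 'k)"
    "\<And>g g'::'g. dbasis g 0 \<odot> dbasis g' 0 = of_bool (g = g') *s (dbasis g 0 :: 'k ^ ('g \<times> 'g))"
    "(\<Sum>g\<in>UNIV. dbasis (g::'g) 0) = (\<one> :: 'k ^ ('g \<times> 'g))"
    "\<And>s. \<Delta> (?K s) = tensor (?K s) (?K s)" "\<And>s. \<epsilon> (?K s) = 1" "?K 0 = \<one>"
    "\<And>s t. ?K s \<odot> ?K t = ?K (s + t)"
    "\<And>s g. ?K s \<odot> dbasis g 0 = dbasis (s + g - s) 0 \<odot> ?K s"
    using double_relations_dbasis[where 'k='k and 'g='g] unfolding double_relations_def by blast+
  show "double_relations a K"
    unfolding double_relations_def a_def K_def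
    by (simp only: comult counit rel tm tms one refl flip: mult)
       (simp add: one scale rel flip: sum)
  show "\<psi> (dbasis g s) = a g \<odot> K s"
    unfolding a_def K_def by (simp only: dbasis_factor flip: mult)
qed

lemma linear_eqI_dbasis:
  fixes f f' :: "'k::field ^ ('g::finite \<times> 'g) \<Rightarrow> 'k ^ 'j::finite"
  assumes "Vector_Spaces.linear (*s) (*s) f" "Vector_Spaces.linear (*s) (*s) f'"
    and "\<And>g s. f (dbasis g s) = f' (dbasis g s)"
  shows "f a = f' a"
  by (subst linear_axis_sum[OF assms(1)], subst linear_axis_sum[OF assms(2)], rule sum.cong)
     (auto simp: assms(3)[unfolded dbasis_def])

text \<open>
  The case in use is that \<open>b\<close> is group-like, so that \<open>c\<close> and \<open>d\<close> both equal \<open>b\<close>: the coproduct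
  of \<open>a g \<odot> K s\<close> then follows from the coproducts of its two factors.
\<close>

lemma dcomult_dmult_tensor:
  assumes "\<Delta> a = (\<Sum>i\<in>I. tensor (p i) (q i))" and "\<Delta> b = tensor c d"
  shows "\<Delta> (a \<odot> b) = (\<Sum>i\<in>I. tensor (p i \<odot> c) (q i \<odot> d))"
proof -
  have lin: "Vector_Spaces.linear (*s) (*s) (\<lambda>x. tensor (f x) y)" "Vector_Spaces.linear (*s) (*s) (\<lambda>x. tensor y (f x))"
    if "Vector_Spaces.linear (*s) (*s) f" for f :: "'a ^ _ \<Rightarrow> 'a ^ _" and y :: "'a ^ _"
  proof -
    interpret Vector_Spaces.linear "(*s)" "(*s)" f by (rule that)
    show "Vector_Spaces.linear (*s) (*s) (\<lambda>x. tensor (f x) y)" "Vector_Spaces.linear (*s) (*s) (\<lambda>x. tensor y (f x))"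
      by (rule linear_vecI; simp add: add scale tensor_def vec_eq_iff algebra_simps)+
  qed
  have "tensor_lift (\<lambda>b1 b2. tensor (x \<odot> b1) (y \<odot> b2)) (\<Delta> b) = tensor (x \<odot> c) (y \<odot> d)" for x y
    unfolding assms by (rule tensor_lift_tensor; intro lin linear_dmult)
  then have "\<Delta> (a \<odot> b) = tensor_lift (\<lambda>a1 a2. tensor (a1 \<odot> c) (a2 \<odot> d)) (\<Delta> a)"
    by (simp add: dd_comult_mult)
  also have "\<dots> = (\<Sum>i\<in>I. tensor (p i \<odot> c) (q i \<odot> d))"
    unfolding assms tensor_lift_sum
    by (intro sum.cong refl, rule tensor_lift_tensor; intro lin linear_dmult)
  finally show ?thesis .
qed

lemma dcounit_sum: "\<epsilon> (\<Sum>i\<in>I. f i) = (\<Sum>i\<in>I. \<epsilon> (f i))"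
  and dcounit_scale: "\<epsilon> (c *s a) = c * \<epsilon> a"
proof -
  interpret Vector_Spaces.linear "(*s)" "(*)" \<epsilon> by (rule linear_dcounit)
  show "\<epsilon> (\<Sum>i\<in>I. f i) = (\<Sum>i\<in>I. \<epsilon> (f i))" "\<epsilon> (c *s a) = c * \<epsilon> a"
    by (simp_all add: sum scale)
qed

lemma of_bool_smult: "of_bool P *s a = (if P then a else 0)" for a :: "'k::field ^ 'i"
  by simp

text \<open>
  The composites \<open>\<S> \<circ> \<psi>\<close> and \<open>\<psi> \<circ> \<S>\<close> are a left and a right inverse of \<open>\<psi>\<close> for the
  convolution product of linear maps, so they coincide. On basis vectors the second index is
  constant, and the convolution product is a sum over the factorisations of the first index.
\<close>

lemma bialgebra_map_antipode:
  fixes \<psi> :: "'k::field ^ ('g::{group_add,finite} \<times> 'g) \<Rightarrow> 'k ^ ('h::{group_add,finite} \<times> 'h)"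
  assumes mult: "\<And>x y. \<psi> (x \<odot> y) = \<psi> x \<odot> \<psi> y" and one: "\<psi> \<one> = \<one>"
    and lin: "Vector_Spaces.linear (*s) (*s) \<psi>"
    and comult: "\<And>x. \<Delta> (\<psi> x) = tensor_map \<psi> \<psi> (\<Delta> x)" and counit: "\<And>x. \<epsilon> (\<psi> x) = \<epsilon> x"
  shows "\<psi> (\<S> a) = \<S> (\<psi> a)"
proof (rule linear_eqI_dbasis[of "\<lambda>x. \<psi> (\<S> x)" "\<lambda>x. \<S> (\<psi> x)"])
  show "Vector_Spaces.linear (*s) (*s) (\<lambda>x. \<psi> (\<S> x))" "Vector_Spaces.linear (*s) (*s) (\<lambda>x. \<S> (\<psi> x))"
    by (rule linear_compose[OF linear_dantipode lin] linear_compose[OF lin linear_dantipode])+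
next
  fix g s :: 'g
  interpret Vector_Spaces.linear "(*s)" "(*s)" \<psi> by (rule lin)
  (* E is the map itself on the basis vectors with second index s; F and E' are its candidate
     convolution inverses, on the left and on the right. *)
  define E where "E g = \<psi> (dbasis g s)" for g
  define F where "F g = \<S> (E g)" for g
  define E' where "E' g = \<psi> (\<S> (dbasis g s))" for g
  have E: "\<Delta> (E g) = (\<Sum>x\<in>UNIV. tensor (E x) (E (g - x)))" for g
    unfolding E_def by (simp only: comult dcomult_dbasis tensor_map_sum_tensor[OF lin lin])
  have FE: "(\<Sum>x\<in>UNIV. F x \<odot> E (g - x)) = of_bool (g = 0) *s \<one>" for g
  proof -
    have "tensor_lift (\<lambda>x y. \<S> x \<odot> y) (\<Delta> (E g)) = \<epsilon> (E g) *s \<one>"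
      by (rule dd_antl)
    moreover have "tensor_lift (\<lambda>x y. \<S> x \<odot> y) (tensor x y) = \<S> x \<odot> y" for x y :: "'k ^ ('h \<times> 'h)"
      by (rule tensor_lift_tensor[of "\<lambda>x y. \<S> x \<odot> y"]) (rule linear_dmult linear_compose[OF linear_dantipode linear_dmult(2)])+
    moreover have "\<epsilon> (E g) = of_bool (g = 0)"
      by (simp add: E_def counit dcounit_dbasis)
    ultimately show ?thesis
      by (simp add: E tensor_lift_sum F_def)
  qed
  have EE': "(\<Sum>x\<in>UNIV. E x \<odot> E' (g - x)) = of_bool (g = 0) *s \<one>" for g
  proof -
    have "tensor_lift (\<lambda>x y. x \<odot> \<S> y) (\<Delta> (dbasis g s)) = \<epsilon> (dbasis g s :: 'k ^ _) *s \<one>"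
      by (rule dd_antr)
    moreover have "tensor_lift (\<lambda>x y. x \<odot> \<S> y) (tensor x y) = x \<odot> \<S> y" for x y :: "'k ^ ('g \<times> 'g)"
      by (rule tensor_lift_tensor[of "\<lambda>x y. x \<odot> \<S> y"]) (rule linear_dmult linear_compose[OF linear_dantipode linear_dmult(1)])+
    ultimately have "(\<Sum>x\<in>UNIV. dbasis x s \<odot> \<S> (dbasis (g - x) s)) = of_bool (g = 0) *s (\<one> :: 'k ^ ('g \<times> 'g))"
      by (simp add: dcomult_dbasis tensor_lift_sum dcounit_dbasis)
    from arg_cong[OF this, of \<psi>] show ?thesis
      unfolding E_def E'_def by (simp only: sum mult scale one)
  qed
  have "F g = (\<Sum>y\<in>UNIV. F y \<odot> (of_bool (g - y = 0) *s \<one>))"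
    by (simp only: dmult_scale_right dd_unit) (simp add: of_bool_smult)
  also have "\<dots> = (\<Sum>y\<in>UNIV. \<Sum>x\<in>UNIV. F y \<odot> E x \<odot> E' (g - y - x))"
    by (simp only: EE'[symmetric] dmult_sum_right dd_assoc)
  also have "\<dots> = (\<Sum>y\<in>UNIV. \<Sum>x\<in>UNIV. F y \<odot> E (x - y) \<odot> E' (g - x))"
  proof (rule sum.cong[OF refl])
    fix y
    show "(\<Sum>x\<in>UNIV. F y \<odot> E x \<odot> E' (g - y - x)) = (\<Sum>x\<in>UNIV. F y \<odot> E (x - y) \<odot> E' (g - x))"
      by (rule sum.reindex_bij_witness[where i="\<lambda>x. x - y" and j="\<lambda>x. x + y"])
         (simp_all add: group_word_simps del: add_uminus_conv_diff)
  qed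
  also have "\<dots> = (\<Sum>x\<in>UNIV. (of_bool (x = 0) *s \<one>) \<odot> E' (g - x))"
    by (subst sum.swap) (simp only: FE[symmetric] dmult_sum_left)
  also have "\<dots> = E' g"
    by (simp only: dmult_scale_left dd_unit) (simp add: of_bool_smult)
  finally show "\<psi> (\<S> (dbasis g s)) = \<S> (\<psi> (dbasis g s))"
    by (simp add: F_def E_def E'_def)
qed

text \<open>
  In a product of two images the middle factors are exchanged with the commutation rule, after
  which the relations for \<open>a\<close> and for \<open>K\<close> apply separately.
\<close>

lemma double_relations_morphism:
  fixes \<psi> :: "'k::field ^ ('g::{group_add,finite} \<times> 'g) \<Rightarrow> 'k ^ ('h::{group_add,finite} \<times> 'h)"
  assumes lin: "Vector_Spaces.linear (*s) (*s) \<psi>"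
    and rel: "double_relations a K" and \<psi>: "\<And>g s. \<psi> (dbasis g s) = a g \<odot> K s"
  shows "hopf_morphism drinfeld_double drinfeld_double \<psi>"
proof -
  interpret Vector_Spaces.linear "(*s)" "(*s)" \<psi> by (rule lin)
  have comult_a: "\<Delta> (a g) = (\<Sum>x\<in>UNIV. tensor (a x) (a (g - x)))"
    and counit_a: "\<epsilon> (a g) = of_bool (g = 0)"
    and mult_a: "a g \<odot> a g' = of_bool (g = g') *s a g"
    and unit_a: "(\<Sum>g\<in>UNIV. a g) = \<one>"
    and comult_K: "\<Delta> (K s) = tensor (K s) (K s)"
    and counit_K: "\<epsilon> (K s) = 1" and unit_K: "K 0 = \<one>"
    and mult_K: "K s \<odot> K t = K (s + t)"
    and cross: "K s \<odot> a g = a (s + g - s) \<odot> K s" for g g' s t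
    using rel unfolding double_relations_def by blast+
  have counit_mult: "\<epsilon> (x \<odot> y) = \<epsilon> x * \<epsilon> y" for x y :: "'k ^ ('h \<times> 'h)"
    using hopf_algebra_drinfeld_double unfolding hopf_algebra_def by blast
  have "a h \<odot> K g \<odot> (a x \<odot> K y) = \<psi> (dbasis h g \<odot> dbasis x y)" for h g x y
  proof -
    have "a h \<odot> K g \<odot> (a x \<odot> K y) = a h \<odot> (K g \<odot> a x) \<odot> K y"
      by (simp only: dd_assoc)
    also have "\<dots> = (a h \<odot> a (g + x - g)) \<odot> (K g \<odot> K y)"
      by (simp only: cross dd_assoc)
    also have "\<dots> = \<psi> (dbasis h g \<odot> dbasis x y)"
      by (simp only: mult_a mult_K dbasis_mult scale \<psi> dmult_scale_left)
    finally show ?thesis .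
  qed
  then have mult_basis: "\<psi> (dbasis h g \<odot> dbasis x y) = \<psi> (dbasis h g) \<odot> \<psi> (dbasis x y)" for h g x y
    by (simp only: \<psi>)
  have "\<psi> (x \<odot> dbasis p q) = \<psi> x \<odot> \<psi> (dbasis p q)" for x p q
    by (rule linear_eqI_dbasis[OF linear_compose[OF linear_dmult(2) lin] linear_compose[OF lin linear_dmult(2)] mult_basis])
  then have mult: "\<psi> (x \<odot> y) = \<psi> x \<odot> \<psi> y" for x y
    by (rule linear_eqI_dbasis[OF linear_compose[OF linear_dmult(1) lin] linear_compose[OF lin linear_dmult(1)]])
  have one: "\<psi> \<one> = \<one>"
  proof -
    have "\<psi> (\<Sum>g\<in>UNIV. dbasis g 0) = \<one>"
      by (simp only: sum \<psi> unit_K dd_unit unit_a)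
    then show ?thesis by (simp add: drinfeld_double_def)
  qed
  note tms = tensor_map_sum_tensor[OF lin lin]
  have comult: "\<Delta> (\<psi> x) = tensor_map \<psi> \<psi> (\<Delta> x)" for x
  proof (rule linear_eqI_dbasis[OF linear_compose[OF lin linear_dcomult]])
    show "Vector_Spaces.linear (*s) (*s) (\<lambda>x. tensor_map \<psi> \<psi> (\<Delta> x))"
      by (rule linear_compose[OF linear_dcomult])
         (auto intro!: linear_vecI simp: tensor_map_def tensor_lift_add tensor_lift_scale)
    show "\<Delta> (\<psi> (dbasis g s)) = tensor_map \<psi> \<psi> (\<Delta> (dbasis g s))" for g s
      by (simp only: \<psi> dcomult_dbasis tms dcomult_dmult_tensor[OF comult_a comult_K])
  qed
  have counit: "\<epsilon> (\<psi> x) = \<epsilon> x" for x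
  proof -
    have x: "x = (\<Sum>i\<in>UNIV. x $ i *s axis i 1)" by (simp only: basis_expansion)
    have "\<epsilon> (\<psi> (axis i 1)) = \<epsilon> (axis i 1 :: 'k ^ ('g \<times> 'g))" for i
    proof -
      have "\<epsilon> (axis i 1 :: 'k ^ ('g \<times> 'g)) = of_bool (fst i = 0)"
        using dcounit_dbasis[of "fst i" "snd i"] by (simp add: dbasis_def)
      then show ?thesis
        using \<psi>[of "fst i" "snd i", unfolded dbasis_def] by (simp add: counit_mult counit_a counit_K)
    qed
    then show ?thesis
      by (subst (1 2) x) (simp only: sum scale dcounit_sum dcounit_scale)
  qed
  show ?thesis
    unfolding hopf_morphism_def
    using lin mult one comult counit bialgebra_map_antipode[OF mult one lin comult counit]
    by blast
qed

section \<open>Coalgebra maps out of the dual as convolution products\<close>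

text \<open>
  This is multiplication in the group algebra \<open>k[G]\<close>. For fixed \<open>w\<close> and \<open>z\<close> the functions
  \<open>\<theta> w\<close> and \<open>\<lambda>g. lam g z\<close> are elements of \<open>k[G]\<close>. In a compatible quadruple, \<open>\<theta>\<close> turns
  addition into this product, the functions given by \<open>lam\<close> are orthogonal idempotents, and the
  two kinds of elements commute.
\<close>

definition conv :: "('g::{group_add,finite} \<Rightarrow> 'k::field) \<Rightarrow> ('g \<Rightarrow> 'k) \<Rightarrow> 'g \<Rightarrow> 'k" (infixl "\<star>" 70) where
  "(f \<star> f') g = (\<Sum>x\<in>UNIV. f x * f' (- x + g))"

lemma conv_altdef: "(f \<star> f') g = (\<Sum>x\<in>UNIV. f (g - x) * f' x)"
  unfolding conv_def
  by (rule sum.reindex_bij_witness[where i="\<lambda>x. g - x" and j="\<lambda>x. - x + g"])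
     (simp_all add: group_word_simps del: add_uminus_conv_diff)

lemma conv_assoc: "f \<star> f' \<star> f'' = f \<star> (f' \<star> f'')"
proof
  fix g
  have "(f \<star> f' \<star> f'') g = (\<Sum>y\<in>UNIV. \<Sum>x\<in>UNIV. f y * (f' (- y + x) * f'' (- x + g)))"
    unfolding conv_def sum_distrib_right by (subst sum.swap) (simp add: mult.assoc)
  also have "\<dots> = (\<Sum>y\<in>UNIV. \<Sum>x\<in>UNIV. f y * (f' x * f'' (- x + (- y + g))))"
  proof (rule sum.cong[OF refl])
    fix y
    show "(\<Sum>x\<in>UNIV. f y * (f' (- y + x) * f'' (- x + g))) = (\<Sum>x\<in>UNIV. f y * (f' x * f'' (- x + (- y + g))))"
      by (rule sum.reindex_bij_witness[where i="\<lambda>x. y + x" and j="\<lambda>x. - y + x"])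
         (simp_all add: group_word_simps del: add_uminus_conv_diff)
  qed
  also have "\<dots> = (f \<star> (f' \<star> f'')) g"
    by (simp add: conv_def sum_distrib_left)
  finally show "(f \<star> f' \<star> f'') g = (f \<star> (f' \<star> f'')) g" .
qed

lemma conv_scale_left: "(\<lambda>g. c * f g) \<star> f' = (\<lambda>g. c * (f \<star> f') g)"
  by (auto simp: conv_def sum_distrib_left mult_ac)

text \<open>
  The image of \<open>e\<^sub>g # 0\<close> under the map attached to a quadruple: the convolution product of
  the component \<open>\<theta>\<close> in the dual of \<open>k[H]\<close> and the component \<open>lam\<close> in \<open>k[H]\<close>.
\<close>

definition dual_image ::
  "('h::finite \<Rightarrow> 'g::{group_add,finite} \<Rightarrow> 'k::field) \<Rightarrow> ('g \<Rightarrow> 'h \<Rightarrow> 'k) \<Rightarrow> 'g \<Rightarrow> 'k ^ ('h \<times> 'h)"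
where
  "dual_image \<theta> lam g = (\<chi> p. \<Sum>x\<in>UNIV. \<theta> (fst p) x * lam (g - x) (snd p))"

lemma dual_image_nth: "dual_image \<theta> lam g $ (w, z) = (\<Sum>x\<in>UNIV. \<theta> w x * lam (g - x) z)"
  by (simp add: dual_image_def)

lemma dual_image_conv: "dual_image \<theta> lam g $ (w, z) = ((\<lambda>x. lam x z) \<star> \<theta> w) g"
  by (simp add: dual_image_nth conv_altdef mult.commute)

text \<open>
  The coefficient at \<open>(w, u)\<close> forces \<open>z = u - v s\<close> and \<open>y = - z + w + z\<close>, so the triple sum
  factors as the product of the images of \<open>e\<^sub>g # 0\<close> and \<open>1 # s\<close>.
\<close>

lemma psi_value:
  fixes lam :: "'g::{group_add,finite} \<Rightarrow> 'h::{group_add,finite} \<Rightarrow> 'k::field"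
  shows "(\<Sum>x\<in>UNIV. \<Sum>y\<in>UNIV. \<Sum>z\<in>UNIV. (lam (g - x) z * \<omega> s y) *s
      smash (\<lambda>w. \<theta> w x * of_bool (w = z + y - z)) (z + v s)) =
    dual_image \<theta> lam g \<odot> smash (\<omega> s) (v s)"
proof (rule vec_eq_iff[THEN iffD2], clarify)
  fix w u
  define z0 where "z0 = u - v s"
  have u: "(u = z + v s) = (z = z0)" for z
    unfolding z0_def by (metis add_diff_cancel diff_add_cancel)
  have "(\<Sum>x\<in>UNIV. \<Sum>y\<in>UNIV. \<Sum>z\<in>UNIV. (lam (g - x) z * \<omega> s y) *s
      smash (\<lambda>w. \<theta> w x * of_bool (w = z + y - z)) (z + v s)) $ (w, u) =
    (\<Sum>x\<in>UNIV. \<Sum>y\<in>UNIV. \<Sum>z\<in>UNIV. of_bool (z = z0) *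
       (of_bool (y = - z + w + z) * (\<theta> w x * lam (g - x) z * \<omega> s y)))"
    unfolding sum_component vector_smult_component smash_nth u eq_conj_iff
    by (intro sum.cong refl) (auto simp: mult_ac)
  also have "\<dots> = (\<Sum>x\<in>UNIV. \<theta> w x * lam (g - x) z0) * \<omega> s (- z0 + w + z0)"
    by (simp only: sum_of_bool_delta sum_distrib_right)
  also have "\<dots> = (dual_image \<theta> lam g \<odot> smash (\<omega> s) (v s)) $ (w, u)"
    by (simp only: dmult_smash_nth dual_image_nth z0_def)
  finally show "(\<Sum>x\<in>UNIV. \<Sum>y\<in>UNIV. \<Sum>z\<in>UNIV. (lam (g - x) z * \<omega> s y) *s
      smash (\<lambda>w. \<theta> w x * of_bool (w = z + y - z)) (z + v s)) $ (w, u) =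
    (dual_image \<theta> lam g \<odot> smash (\<omega> s) (v s)) $ (w, u)" .
qed

lemma sum_product_interchange:
  fixes A B C D :: "'a::finite \<Rightarrow> 'b::finite \<Rightarrow> 'k::field"
  shows "(\<Sum>z\<in>UNIV. \<Sum>z'\<in>UNIV. (\<Sum>x\<in>UNIV. A x z * B x z') * (\<Sum>q\<in>UNIV. C q z * D q z')) =
    (\<Sum>x\<in>UNIV. \<Sum>q\<in>UNIV. (\<Sum>z\<in>UNIV. A x z * C q z) * (\<Sum>z'\<in>UNIV. B x z' * D q z'))"
proof -
  have "(\<Sum>p\<in>UNIV. \<Sum>r\<in>UNIV. A (fst r) (fst p) * B (fst r) (snd p) * (C (snd r) (fst p) * D (snd r) (snd p))) =
    (\<Sum>r\<in>UNIV. \<Sum>p\<in>UNIV. A (fst r) (fst p) * C (snd r) (fst p) * (B (fst r) (snd p) * D (snd r) (snd p)))"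
    by (subst sum.swap) (simp only: mult_ac)
  then show ?thesis by (simp only: sum_UNIV_prod fst_conv snd_conv sum_product)
qed

lemma sum_shift: "(\<Sum>g\<in>UNIV. f (g - x)) = (\<Sum>g\<in>UNIV. f g)" for x :: "'g::{group_add,finite}"
  by (rule sum.reindex_bij_witness[where i="\<lambda>g. g + x" and j="\<lambda>g. g - x"]) auto

section \<open>Compatible quadruples satisfy the relations\<close>

text \<open>
  The multiplicative relations involving \<open>a\<close> are the delicate ones, since the hypotheses state
  them only after projection to one component or the other. The facts \<open>split\<close> and \<open>sum_product_interchange\<close> separate
  the two components of a product, so that each can be evaluated with its own hypothesis.
\<close>

lemma compatible_double_relations:
  fixes lam :: "'g::{group_add,finite} \<Rightarrow> 'h::{group_add,finite} \<Rightarrow> 'k::field"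
  assumes c: "compatible_quadruple lam \<omega> \<theta> v"
  shows "double_relations (dual_image \<theta> lam) (\<lambda>s. smash (\<omega> s) (v s))"
proof -
  have v: "v (g + g') = v g + v g'"
    and \<theta>_0: "\<theta> 0 g = of_bool (g = 0)" and \<theta>_sum: "(\<Sum>x\<in>UNIV. \<theta> h x) = 1"
    and \<theta>_add: "\<theta> (h + h') g = (\<Sum>x\<in>UNIV. \<theta> h x * \<theta> h' (- x + g))"
    and \<omega>_0: "\<omega> 0 h = 1" and \<omega>_add: "\<omega> g (h + h') = \<omega> g h * \<omega> g h'"
    and lam_sum1: "(\<Sum>y\<in>UNIV. lam g y) = of_bool (g = 0)"
    and lam_sum2: "(\<Sum>x\<in>UNIV. lam x h) = of_bool (0 = h)"
    and lam_mult: "(\<Sum>y\<in>UNIV. lam g y * lam g' (- y + h)) = of_bool (g = g') * lam g h"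
    and lam_comult: "(\<Sum>x\<in>UNIV. lam x h * lam (g - x) h') = of_bool (h = h') * lam g h"
    and comm: "(\<Sum>x\<in>UNIV. \<theta> h x * lam (g - x) h') = (\<Sum>x\<in>UNIV. \<theta> h x * lam (- x + g) h')"
    and \<theta>_mult: "(\<Sum>x\<in>UNIV. \<Sum>y\<in>UNIV. lam (g - x) y * \<theta> h x * \<theta> (- y + h + y) g') = of_bool (g = g') * \<theta> h g"
    and \<omega>_mult: "\<omega> g h * \<omega> g' (- v g + h + v g) = \<omega> (g + g') h"
    and cross: "(\<Sum>x\<in>UNIV. \<Sum>y\<in>UNIV. \<theta> h (x - g) * \<omega> g (- y + h + y) * lam (g + g' - x) y) =
       \<omega> g h * \<theta> (- v g + h + v g) g'"
    and lam_conj: "lam (g + g' - g) (v g + h - v g) = lam g' h" for g g' h h'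
    using c unfolding compatible_quadruple_def by (elim conjE; iprover)+
  define L where "L z x = lam x z" for z x
  let ?a = "dual_image \<theta> lam"
  have a: "?a g $ (w, z) = (L z \<star> \<theta> w) g" for g w z
    unfolding L_def by (rule dual_image_conv)
  have L_\<theta>: "L z \<star> \<theta> w = \<theta> w \<star> L z" for z w
  proof
    fix g
    show "(L z \<star> \<theta> w) g = (\<theta> w \<star> L z) g"
      using comm[of w g z] by (simp add: conv_altdef[of "L z"] conv_def[of "\<theta> w"] L_def mult.commute)
  qed
  have L_L: "L z' \<star> L z = (\<lambda>g. of_bool (z = z') * L z g)" for z z'
    using lam_comult[of z _ z'] by (simp add: fun_eq_iff conv_altdef L_def mult.commute)
  have \<theta>_\<theta>: "\<theta> h \<star> \<theta> h' = \<theta> (h + h')" for h h'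
    by (simp add: fun_eq_iff conv_def \<theta>_add)
  (* Projecting the right tensor factor of the coproduct of a to k[H] reads off the coordinate z
     and leaves a unchanged. It holds since the elements L z of k[G] are orthogonal idempotents,
     which is what compatibility of lam with the comultiplications says. *)
  have split: "(\<Sum>x\<in>UNIV. ?a x $ (w, z) * lam (g - x) z') = of_bool (z = z') * ?a g $ (w, z)" for w z z' g
  proof -
    have "(\<Sum>x\<in>UNIV. ?a x $ (w, z) * lam (g - x) z') = (L z' \<star> (L z \<star> \<theta> w)) g"
      by (simp add: conv_altdef[of "L z'"] a) (simp add: L_def mult.commute)
    then show ?thesis
      by (simp only: conv_assoc[symmetric] L_L conv_scale_left a)
  qed
  have comult_a: "(\<Sum>x\<in>UNIV. ?a x $ (w, u) * ?a (g - x) $ (w', u')) = of_bool (u' = u) * ?a g $ (w' + w, u)"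
    for g w u w' u'
  proof -
    have "(\<Sum>x\<in>UNIV. ?a x $ (w, u) * ?a (g - x) $ (w', u')) = ((L u' \<star> \<theta> w') \<star> (L u \<star> \<theta> w)) g"
      by (simp add: conv_altdef[of "L u' \<star> \<theta> w'"] a mult.commute)
    also have "(L u' \<star> \<theta> w') \<star> (L u \<star> \<theta> w) = (L u' \<star> L u) \<star> (\<theta> w' \<star> \<theta> w)"
      by (metis conv_assoc L_\<theta>)
    finally show ?thesis
      by (auto simp: L_L \<theta>_\<theta> conv_scale_left a)
  qed
  have counit_a: "(\<Sum>u\<in>UNIV. ?a g $ (0, u)) = of_bool (g = 0)" for g
  proof -
    have "?a g $ (0, u) = lam g u" for u
    proof -
      have "?a g $ (0, u) = (\<Sum>x\<in>UNIV. of_bool (x = 0) * lam (g - x) u)"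
        by (simp only: dual_image_nth \<theta>_0)
      then show ?thesis by (simp only: sum_of_bool_delta diff_0_right)
    qed
    then show ?thesis by (simp add: lam_sum1)
  qed
  have \<theta>_a: "(\<Sum>z\<in>UNIV. ?a x $ (w, z) * \<theta> (- z + w + z) q) = of_bool (x = q) * \<theta> w x" for x w q
    unfolding \<theta>_mult[symmetric] by (subst sum.swap) (simp only: dual_image_nth sum_distrib_right, simp only: mult_ac)
  have mult_a: "(\<Sum>z\<in>UNIV. ?a g $ (w, z) * ?a g' $ (- z + w + z, - z + u)) = of_bool (g = g') * ?a g $ (w, u)"
    for g g' w u
  proof -
    have cancel: "(g - x = g' - x) = (g = g')" for x
      by (metis diff_add_cancel)
    (* Duplicate the summation variable z with a delta, turn the delta into a sum with split, and
       regroup: one group of factors involves only z and the other only z'. *)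
    have "(\<Sum>z\<in>UNIV. ?a g $ (w, z) * ?a g' $ (- z + w + z, - z + u)) =
        (\<Sum>z\<in>UNIV. \<Sum>z'\<in>UNIV. of_bool (z' = z) * (?a g $ (w, z) * ?a g' $ (- z + w + z, - z' + u)))"
      by (simp only: sum_of_bool_delta)
    also have "\<dots> = (\<Sum>z\<in>UNIV. \<Sum>z'\<in>UNIV. (\<Sum>x\<in>UNIV. ?a x $ (w, z) * lam (g - x) z') *
        (\<Sum>q\<in>UNIV. \<theta> (- z + w + z) q * lam (g' - q) (- z' + u)))"
      by (simp only: split dual_image_nth[of \<theta> lam g'] mult.assoc eq_commute)
    also have "\<dots> = (\<Sum>x\<in>UNIV. \<Sum>q\<in>UNIV. (\<Sum>z\<in>UNIV. ?a x $ (w, z) * \<theta> (- z + w + z) q) *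
        (\<Sum>z'\<in>UNIV. lam (g - x) z' * lam (g' - q) (- z' + u)))"
      by (rule sum_product_interchange)
    also have "\<dots> = (\<Sum>x\<in>UNIV. \<Sum>q\<in>UNIV. of_bool (q = x) * (\<theta> w x * (of_bool (g - x = g' - q) * lam (g - x) u)))"
      by (simp only: \<theta>_a lam_mult mult.assoc eq_commute)
    also have "\<dots> = (\<Sum>x\<in>UNIV. of_bool (g = g') * (\<theta> w x * lam (g - x) u))"
      by (simp only: sum_of_bool_delta, simp only: cancel mult.left_commute)
    also have "\<dots> = of_bool (g = g') * ?a g $ (w, u)"
      by (simp only: dual_image_nth sum_distrib_left)
    finally show ?thesis .
  qed
  have unit_a: "(\<Sum>g\<in>UNIV. ?a g $ (w, u)) = of_bool (u = 0)" for w u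
  proof -
    have "(\<Sum>g\<in>UNIV. ?a g $ (w, u)) = (\<Sum>x\<in>UNIV. \<Sum>g\<in>UNIV. \<theta> w x * lam (g - x) u)"
      unfolding dual_image_nth by (rule sum.swap)
    also have "\<dots> = (\<Sum>x\<in>UNIV. \<theta> w x) * of_bool (0 = u)"
      by (simp only: sum_distrib_left[symmetric] sum_shift[of "\<lambda>g. lam g u"] lam_sum2 sum_distrib_right)
    finally show ?thesis by (auto simp: \<theta>_sum)
  qed
  have v_0: "v 0 = 0" using v[of 0 0] by (metis add_0_right add_left_cancel)
  (* Multiplicativity in the second argument makes this value idempotent; multiplicativity in the
     first makes it a unit. *)
  have \<omega>_at_0: "\<omega> s 0 = 1" for s
  proof -
    have "\<omega> s 0 * \<omega> (- s) 0 = 1" using \<omega>_mult[of s 0 "- s"] by (simp add: \<omega>_0)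
    moreover have "\<omega> s 0 = \<omega> s 0 * \<omega> s 0" using \<omega>_add[of s 0 0] by simp
    ultimately show ?thesis by (metis mult_cancel_left1 mult_zero_left zero_neq_one)
  qed
  have cross_a: "\<omega> s w * ?a g $ (- v s + w + v s, - v s + u) =
      ?a (s + g - s) $ (w, u - v s) * \<omega> s (- (u - v s) + w + (u - v s))" for s g w u
  proof -
    (* The hypothesis gives the component of the relation in the dual; conjugation invariance of
       lam gives the other one, and split joins them. *)
    have cross': "\<omega> s w * \<theta> (- v s + w + v s) q = (\<Sum>y\<in>UNIV. \<omega> s (- y + w + y) * ?a (s + q - s) $ (w, y))" for q
    proof -
      have "\<omega> s w * \<theta> (- v s + w + v s) q =
          (\<Sum>y\<in>UNIV. \<omega> s (- y + w + y) * (\<Sum>x\<in>UNIV. \<theta> w (x - s) * lam (s + q - x) y))"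
        unfolding cross[symmetric] by (subst sum.swap) (simp only: sum_distrib_left, simp only: mult_ac)
      moreover have "(\<Sum>x\<in>UNIV. \<theta> w (x - s) * lam (s + q - x) y) = ?a (s + q - s) $ (w, y)" for y
        unfolding dual_image_nth
        by (rule sum.reindex_bij_witness[where i="\<lambda>x. x + s" and j="\<lambda>x. x - s"])
           (simp_all add: group_word_simps del: add_uminus_conv_diff)
      ultimately show ?thesis by simp
    qed
    have conj: "lam (g - q) (- v s + u) = lam ((s + g - s) - (s + q - s)) (u - v s)" for q
      using lam_conj[of s "g - q" "- v s + u"]
      by (simp add: group_word_simps del: add_uminus_conv_diff)
    have "\<omega> s w * ?a g $ (- v s + w + v s, - v s + u) =
        (\<Sum>q\<in>UNIV. (\<omega> s w * \<theta> (- v s + w + v s) q) * lam (g - q) (- v s + u))"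
      by (simp only: dual_image_nth sum_distrib_left mult.assoc)
    also have "\<dots> = (\<Sum>q\<in>UNIV. (\<Sum>y\<in>UNIV. \<omega> s (- y + w + y) * ?a (s + q - s) $ (w, y)) *
        lam ((s + g - s) - (s + q - s)) (u - v s))"
      by (simp only: cross' conj)
    also have "\<dots> = (\<Sum>q\<in>UNIV. (\<Sum>y\<in>UNIV. \<omega> s (- y + w + y) * ?a q $ (w, y)) *
        lam ((s + g - s) - q) (u - v s))"
      by (rule sum.reindex_bij_witness[where i="\<lambda>x. - s + x + s" and j="\<lambda>x. s + x - s"])
         (simp_all add: group_word_simps del: add_uminus_conv_diff)
    also have "\<dots> = (\<Sum>y\<in>UNIV. \<omega> s (- y + w + y) * (\<Sum>q\<in>UNIV. ?a q $ (w, y) * lam ((s + g - s) - q) (u - v s)))"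
      unfolding sum_distrib_right by (subst sum.swap) (simp only: mult.assoc sum_distrib_left)
    also have "\<dots> = (\<Sum>y\<in>UNIV. of_bool (y = u - v s) * (\<omega> s (- y + w + y) * ?a (s + g - s) $ (w, y)))"
      by (simp only: split mult.left_commute)
    also have "\<dots> = ?a (s + g - s) $ (w, u - v s) * \<omega> s (- (u - v s) + w + (u - v s))"
      by (simp only: sum_of_bool_delta mult.commute)
    finally show ?thesis .
  qed
  have shift: "(- v s + u = v t) = (u = v (s + t))" for s t u
    unfolding v by (metis add_minus_cancel minus_add_cancel)
  show ?thesis
    unfolding double_relations_def
  proof (intro conjI allI)
    show "\<Delta> (?a g) = (\<Sum>x\<in>UNIV. tensor (?a x) (?a (g - x)))" for g
      by (auto simp: vec_eq_iff dd_hcomult_nth tensor_def comult_a)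
    show "\<epsilon> (?a g) = of_bool (g = 0)" for g
      by (simp add: dd_hcounit_eq counit_a)
    show "?a g \<odot> ?a g' = of_bool (g = g') *s ?a g" for g g'
      by (simp only: vec_eq_iff split_paired_All dd_hmult_nth mult_a vector_smult_component simp_thms)
    show "(\<Sum>g\<in>UNIV. ?a g) = \<one>"
      by (simp add: vec_eq_iff unit_a dd_hunit_nth)
    show "\<Delta> (smash (\<omega> s) (v s)) = tensor (smash (\<omega> s) (v s)) (smash (\<omega> s) (v s))" for s
      by (auto simp: vec_eq_iff dd_hcomult_nth tensor_def smash_nth \<omega>_add)
    show "\<epsilon> (smash (\<omega> s) (v s)) = 1" for s
      by (simp add: dd_hcounit_eq smash_nth \<omega>_at_0)
    show "smash (\<omega> 0) (v 0) = \<one>"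
      by (simp add: vec_eq_iff smash_nth dd_hunit_nth v_0 \<omega>_0)
    show "smash (\<omega> s) (v s) \<odot> smash (\<omega> t) (v t) = smash (\<omega> (s + t)) (v (s + t))" for s t
      by (simp add: vec_eq_iff dmult_smash_nth(2) smash_nth shift flip: \<omega>_mult)
    show "smash (\<omega> s) (v s) \<odot> ?a g = ?a (s + g - s) \<odot> smash (\<omega> s) (v s)" for s g
      by (simp only: vec_eq_iff split_paired_All dmult_smash_nth cross_a simp_thms)
  qed
qed

section \<open>The relations determine a compatible quadruple\<close>

text \<open>
  Comparing the coefficients of \<open>\<Delta> a = tensor a a\<close> at two distinct second indices shows that
  \<open>a\<close> lives on at most one, and the counit excludes \<open>a = 0\<close>; at equal second indices the same comparison makes the coefficient
  function multiplicative.
\<close>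

lemma grouplike_smash:
  fixes a :: "'k::field ^ ('h::{group_add,finite} \<times> 'h)"
  assumes comult: "\<Delta> a = tensor a a" and counit: "\<epsilon> a = 1"
  obtains \<phi> v where "a = smash \<phi> v" "\<phi> 0 = 1" "\<And>h h'. \<phi> (h + h') = \<phi> h * \<phi> h'"
proof -
  have nth: "of_bool (u' = u) * a $ (w' + w, u) = a $ (w, u) * a $ (w', u')" for w u w' u'
    using arg_cong[OF comult, of "\<lambda>x. x $ ((w, u), (w', u'))"] by (simp add: dd_hcomult_nth tensor_def)
  have sum1: "(\<Sum>u\<in>UNIV. a $ (0, u)) = 1"
    using counit by (simp add: dd_hcounit_eq)
  then obtain v where v: "a $ (0, v) \<noteq> 0"
    by (metis sum.neutral zero_neq_one)
  have supp: "a $ (w, u) = 0" if "u \<noteq> v" for w u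
    using nth[of u v w 0] that v by simp
  have "(\<Sum>u\<in>UNIV. a $ (0, u)) = (\<Sum>u\<in>UNIV. of_bool (u = v) * a $ (0, u))"
    by (rule sum.cong) (auto simp: supp)
  then have "a $ (0, v) = 1" using sum1 by (simp only: sum_of_bool_delta)
  moreover have "a = smash (\<lambda>w. a $ (w, v)) v"
    by (auto simp: vec_eq_iff smash_nth supp)
  moreover have "a $ (h + h', v) = a $ (h, v) * a $ (h', v)" for h h'
    using nth[of v v h h'] by (simp add: mult.commute)
  ultimately show thesis using that by blast
qed

text \<open>
  Every relation is read in coordinates. Setting the dual coordinate to \<open>0\<close> applies the counit
  of the dual of \<open>k[H]\<close> and leaves \<open>lam\<close>; summing over the group coordinate applies the counit
  of \<open>k[H]\<close> and leaves \<open>\<theta>\<close>. The two mixed ways to project the comultiplication of \<open>a\<close>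
  produce the two sums in the condition that \<open>\<theta>\<close> and \<open>lam\<close> commute.
\<close>

lemma double_relations_quadruple:
  fixes a :: "'g::{group_add,finite} \<Rightarrow> 'k::field ^ ('h::{group_add,finite} \<times> 'h)"
  assumes rel: "double_relations a K"
  obtains lam \<omega> \<theta> v where "compatible_quadruple lam \<omega> \<theta> v"
    "a = dual_image \<theta> lam" "K = (\<lambda>s. smash (\<omega> s) (v s))"
proof -
  have comult_a: "\<Delta> (a g) = (\<Sum>x\<in>UNIV. tensor (a x) (a (g - x)))"
    and counit_a: "\<epsilon> (a g) = of_bool (g = 0)"
    and mult_a: "a g \<odot> a g' = of_bool (g = g') *s a g"
    and unit_a: "(\<Sum>g\<in>UNIV. a g) = \<one>"
    and comult_K: "\<Delta> (K s) = tensor (K s) (K s)"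
    and counit_K: "\<epsilon> (K s) = 1" and unit_K: "K 0 = \<one>"
    and mult_K: "K s \<odot> K t = K (s + t)"
    and cross: "K s \<odot> a g = a (s + g - s) \<odot> K s" for g g' s t
    using rel unfolding double_relations_def by blast+
  have "\<forall>s. \<exists>\<phi> u. K s = smash \<phi> u \<and> \<phi> 0 = 1 \<and> (\<forall>h h'. \<phi> (h + h') = \<phi> h * \<phi> h')"
    using grouplike_smash[OF comult_K counit_K] by metis
  then obtain \<omega> v where K: "\<And>s. K s = smash (\<omega> s) (v s)" and \<omega>_0: "\<And>s. \<omega> s 0 = 1"
    and \<omega>_add: "\<And>s h h'. \<omega> s (h + h') = \<omega> s h * \<omega> s h'"
    by metis
  define lam where "lam g z = a g $ (0, z)" for g z
  define \<theta> where "\<theta> w g = (\<Sum>z\<in>UNIV. a g $ (w, z))" for w g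
  have comult_nth: "of_bool (u' = u) * a g $ (w' + w, u) = (\<Sum>x\<in>UNIV. a x $ (w, u) * a (g - x) $ (w', u'))"
    for g w u w' u'
    using arg_cong[OF comult_a, of "\<lambda>x. x $ ((w, u), (w', u'))" g]
    by (simp add: dd_hcomult_nth tensor_def)
  have a1: "a g $ (w, u) = (\<Sum>x\<in>UNIV. \<theta> w x * lam (g - x) u)" for g w u
  proof -
    have "(\<Sum>z\<in>UNIV. of_bool (z = u) * a g $ (w, z)) = (\<Sum>z\<in>UNIV. \<Sum>x\<in>UNIV. a x $ (w, z) * lam (g - x) u)"
      using comult_nth[of u _ g 0 w] by (simp add: lam_def eq_commute)
    then show ?thesis
      by (simp only: sum_of_bool_delta) (simp only: \<theta>_def sum_distrib_right, rule sum.swap)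
  qed
  have a2: "a g $ (w, u) = (\<Sum>x\<in>UNIV. \<theta> w x * lam (- x + g) u)" for g w u
  proof -
    have "(\<Sum>z\<in>UNIV. of_bool (z = u) * a g $ (w, u)) = (\<Sum>z\<in>UNIV. \<Sum>x\<in>UNIV. lam x u * a (g - x) $ (w, z))"
      using comult_nth[of _ u g w 0] by (simp add: lam_def)
    then have "a g $ (w, u) = (\<Sum>x\<in>UNIV. lam x u * \<theta> w (g - x))"
      by (simp only: sum_of_bool_delta) (simp only: \<theta>_def sum_distrib_left, rule sum.swap)
    also have "\<dots> = (\<Sum>x\<in>UNIV. \<theta> w x * lam (- x + g) u)"
      by (rule sum.reindex_bij_witness[where i="\<lambda>x. - x + g" and j="\<lambda>x. g - x"])
         (simp_all add: group_word_simps mult.commute del: add_uminus_conv_diff)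
    finally show ?thesis .
  qed
  have mult_nth: "(\<Sum>z\<in>UNIV. a g $ (w, z) * a g' $ (- z + w + z, - z + u)) = of_bool (g = g') * a g $ (w, u)"
    for g g' w u
    using arg_cong[OF mult_a, of "\<lambda>x. x $ (w, u)" g g'] by (simp only: dd_hmult_nth vector_smult_component)
  have cross_nth: "\<omega> s w * a g $ (- v s + w + v s, - v s + u) =
      a (s + g - s) $ (w, u - v s) * \<omega> s (- (u - v s) + w + (u - v s))" for s g w u
    using arg_cong[OF cross[of s g], of "\<lambda>x. x $ (w, u)"] by (simp only: K dmult_smash_nth)
  have mult_K_nth: "\<omega> s w * (of_bool (- v s + u = v t) * \<omega> t (- v s + w + v s)) =
      of_bool (u = v (s + t)) * \<omega> (s + t) w" for s t w u
    using arg_cong[OF mult_K[of s t], of "\<lambda>x. x $ (w, u)"] by (simp only: K dmult_smash_nth(2) smash_nth)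
  have unit_nth: "(\<Sum>g\<in>UNIV. a g $ (w, u)) = of_bool (u = 0)" for w u
    using arg_cong[OF unit_a, of "\<lambda>x. x $ (w, u)"] by (simp add: dd_hunit_nth)
  have v_add: "v (s + t) = v s + v t" for s t
    using mult_K_nth[of s 0 "v (s + t)" t] by (auto simp: \<omega>_0 split: if_splits) (metis add_minus_cancel)
  have v_0: "v 0 = 0" using v_add[of 0 0] by (metis add_0_right add_left_cancel)
  have shift: "(\<Sum>u\<in>UNIV. f (- z + u)) = (\<Sum>u\<in>UNIV. f u)" for f :: "'h \<Rightarrow> 'k" and z
    by (rule sum.reindex_bij_witness[where i="\<lambda>u. z + u" and j="\<lambda>u. - z + u"]) (auto simp flip: add.assoc)
  have "compatible_quadruple lam \<omega> \<theta> v"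
    unfolding compatible_quadruple_def
  proof (intro conjI allI)
    show "v (g + g') = v g + v g'" for g g' by (rule v_add)
    show "\<theta> 0 g = of_bool (g = 0)" for g
      using counit_a[of g] by (simp add: \<theta>_def dd_hcounit_eq)
    show "(\<Sum>x\<in>UNIV. \<theta> h x) = 1" for h
      unfolding \<theta>_def by (subst sum.swap) (simp add: unit_nth)
    show "\<omega> 0 h = 1" for h
      using arg_cong[OF unit_K, of "\<lambda>x. x $ (h, v 0)"]
      by (simp add: K smash_nth dd_hunit_nth v_0)
    show "\<omega> g (h + h') = \<omega> g h * \<omega> g h'" for g h h' by (rule \<omega>_add)
    show "(\<Sum>y\<in>UNIV. lam g y) = of_bool (g = 0)" for g
      using counit_a[of g] by (simp add: lam_def dd_hcounit_eq)
    show "(\<Sum>x\<in>UNIV. lam x h) = of_bool (0 = h)" for h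
      by (auto simp: lam_def unit_nth)
    show "(\<Sum>y\<in>UNIV. lam g y * lam g' (- y + h)) = of_bool (g = g') * lam g h" for g g' h
      using mult_nth[of g 0 g' h] by (simp add: lam_def)
    show "(\<Sum>x\<in>UNIV. lam x h * lam (g - x) h') = of_bool (h = h') * lam g h" for g h h'
      using comult_nth[of h' h g 0 0] by (auto simp: lam_def)
    show "(\<Sum>x\<in>UNIV. \<theta> h x * lam (g - x) h') = (\<Sum>x\<in>UNIV. \<theta> h x * lam (- x + g) h')" for g h h'
      by (simp only: a1[symmetric] a2[symmetric])
    show "\<omega> g h * \<omega> g' (- v g + h + v g) = \<omega> (g + g') h" for g g' h
      using mult_K_nth[of g h "v (g + g')" g'] by (simp add: v_add)
    show "lam (g + g' - g) (v g + h - v g) = lam g' h" for g g' h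
    proof -
      have "- (v g + h - v g) + 0 + (v g + h - v g) = 0" "- v g + 0 + v g = 0" "- v g + (v g + h) = h"
        by (simp_all only: add_0_right left_minus minus_add_cancel)
      then show ?thesis
        using cross_nth[of g 0 g' "v g + h"] by (simp only: lam_def \<omega>_0 mult_1_left mult_1_right)
    qed
    show "\<theta> (h + h') g = (\<Sum>x\<in>UNIV. \<theta> h x * \<theta> h' (- x + g))" for h h' g
    proof -
      have "\<theta> (h + h') g = (\<Sum>u\<in>UNIV. \<Sum>u'\<in>UNIV. of_bool (u' = u) * a g $ (h + h', u))"
        by (simp only: sum_of_bool_delta \<theta>_def)
      also have "\<dots> = (\<Sum>x\<in>UNIV. \<Sum>u\<in>UNIV. \<Sum>u'\<in>UNIV. a x $ (h', u) * a (g - x) $ (h, u'))"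
        by (simp only: comult_nth) (rule sum_swap3)
      also have "\<dots> = (\<Sum>x\<in>UNIV. \<theta> h' x * \<theta> h (g - x))"
        by (simp only: \<theta>_def sum_product)
      also have "\<dots> = (\<Sum>x\<in>UNIV. \<theta> h x * \<theta> h' (- x + g))"
        by (rule sum.reindex_bij_witness[where i="\<lambda>x. - x + g" and j="\<lambda>x. g - x"])
           (simp_all add: group_word_simps mult.commute del: add_uminus_conv_diff)
      finally show ?thesis .
    qed
    show "(\<Sum>x\<in>UNIV. \<Sum>y\<in>UNIV. lam (g - x) y * \<theta> h x * \<theta> (- y + h + y) g') = of_bool (g = g') * \<theta> h g" for g g' h
    proof -
      have "(\<Sum>x\<in>UNIV. \<Sum>y\<in>UNIV. lam (g - x) y * \<theta> h x * \<theta> (- y + h + y) g') =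
          (\<Sum>y\<in>UNIV. a g $ (h, y) * \<theta> (- y + h + y) g')"
        by (subst sum.swap) (simp only: a1 sum_distrib_right, simp only: mult_ac)
      also have "\<dots> = (\<Sum>y\<in>UNIV. \<Sum>u\<in>UNIV. a g $ (h, y) * a g' $ (- y + h + y, - y + u))"
        by (simp only: sum_distrib_left[symmetric] shift[of "\<lambda>u. a g' $ (_, u)"] \<theta>_def)
      also have "\<dots> = of_bool (g = g') * \<theta> h g"
        by (subst sum.swap) (simp only: mult_nth \<theta>_def sum_distrib_left)
      finally show ?thesis .
    qed
    show "(\<Sum>x\<in>UNIV. \<Sum>y\<in>UNIV. \<theta> h (x - g) * \<omega> g (- y + h + y) * lam (g + g' - x) y) =
        \<omega> g h * \<theta> (- v g + h + v g) g'" for g g' h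
    proof -
      have conj: "(\<Sum>x\<in>UNIV. \<theta> h (x - g) * lam (g + g' - x) y) = a (g + g' - g) $ (h, y)" for y
        unfolding a1
        by (rule sum.reindex_bij_witness[where i="\<lambda>x. x + g" and j="\<lambda>x. x - g"])
           (simp_all add: group_word_simps del: add_uminus_conv_diff)
      have "(\<Sum>x\<in>UNIV. \<Sum>y\<in>UNIV. \<theta> h (x - g) * \<omega> g (- y + h + y) * lam (g + g' - x) y) =
          (\<Sum>y\<in>UNIV. a (g + g' - g) $ (h, y) * \<omega> g (- y + h + y))"
        unfolding conj[symmetric] sum_distrib_right by (subst sum.swap) (simp only: mult_ac)
      also have "\<dots> = (\<Sum>u\<in>UNIV. a (g + g' - g) $ (h, u - v g) * \<omega> g (- (u - v g) + h + (u - v g)))"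
        by (rule sum_shift[symmetric])
      also have "\<dots> = \<omega> g h * \<theta> (- v g + h + v g) g'"
        by (simp only: cross_nth[symmetric] sum_distrib_left[symmetric] shift[of "\<lambda>u. a g' $ (_, u)"] \<theta>_def)
      finally show ?thesis .
    qed
  qed
  moreover have "a = dual_image \<theta> lam"
    by (simp add: fun_eq_iff vec_eq_iff dual_image_nth a1)
  moreover have "K = (\<lambda>s. smash (\<omega> s) (v s))" by (simp add: K fun_eq_iff)
  ultimately show thesis by (rule that)
qed

section \<open>The correspondence\<close>

lemma psi_of_eq:
  "psi_of lam \<omega> \<theta> v a =
    (\<Sum>g\<in>UNIV. \<Sum>s\<in>UNIV. a $ (g, s) *s (dual_image \<theta> lam g \<odot> smash (\<omega> s) (v s)))"
  unfolding psi_of_def psi_value ..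

lemma linear_psi_of: "Vector_Spaces.linear (*s) (*s) (psi_of lam \<omega> \<theta> v)"
  unfolding psi_of_eq[abs_def]
  by (rule linear_vecI) (simp_all add: sum.distrib vec.scale_left_distrib vec.scale_sum_right)

lemma psi_of_dbasis:
  "psi_of lam \<omega> \<theta> v (dbasis g s) = dual_image \<theta> lam g \<odot> smash (\<omega> s) (v s)"
  unfolding psi_of_eq vec_eq_iff
  by (simp only: sum_component vector_smult_component dbasis_nth mult.assoc sum_of_bool_delta2 simp_thms)

text \<open>
  The products \<open>a g \<odot> K s\<close>, which are the values of the morphism on the basis, determine both
  families.
\<close>

lemma double_relations_recover:
  assumes "double_relations a K"
  shows "a g = a g \<odot> K 0" and "K s = (\<Sum>g\<in>UNIV. a g \<odot> K s)"
  using assms unfolding double_relations_def by (simp_all add: dd_unit flip: dmult_sum_left)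

lemma quadruple_recover:
  fixes lam :: "'g::{group_add,finite} \<Rightarrow> 'h::{group_add,finite} \<Rightarrow> 'k::field"
  assumes "compatible_quadruple lam \<omega> \<theta> v"
  shows "lam g z = dual_image \<theta> lam g $ (0, z)"
    and "\<theta> w g = (\<Sum>z\<in>UNIV. dual_image \<theta> lam g $ (w, z))"
    and "\<omega> s 0 = 1"
proof -
  have \<theta>_0: "\<theta> 0 g = of_bool (g = 0)" and lam_sum: "(\<Sum>y\<in>UNIV. lam g y) = of_bool (g = 0)" for g
    using assms unfolding compatible_quadruple_def by (elim conjE; iprover)+
  have "dual_image \<theta> lam g $ (0, z) = (\<Sum>x\<in>UNIV. of_bool (x = 0) * lam (g - x) z)"
    by (simp only: dual_image_nth \<theta>_0)
  then show "lam g z = dual_image \<theta> lam g $ (0, z)"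
    by (simp only: sum_of_bool_delta diff_0_right)
  have "(\<Sum>z\<in>UNIV. dual_image \<theta> lam g $ (w, z)) = (\<Sum>x\<in>UNIV. of_bool (x = g) * \<theta> w x)"
    unfolding dual_image_nth
    by (subst sum.swap) (auto simp: lam_sum simp flip: sum_distrib_left intro!: sum.cong)
  then show "\<theta> w g = (\<Sum>z\<in>UNIV. dual_image \<theta> lam g $ (w, z))"
    by (simp only: sum_of_bool_delta)
  have "\<epsilon> (smash (\<omega> s) (v s)) = 1"
    using compatible_double_relations[OF assms] unfolding double_relations_def by blast
  then show "\<omega> s 0 = 1" by (simp add: dd_hcounit_eq smash_nth)
qed

text \<open>
  The value \<open>1\<close> at \<open>0\<close> is what makes the support of the element visible.
\<close>

lemma smash_eqD:
  assumes "smash \<phi> u = smash \<phi>' u'" and "\<phi> 0 = 1"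
  shows "\<phi> = \<phi>'" and "u = u'"
proof -
  have nth: "of_bool (y = u) * \<phi> x = of_bool (y = u') * \<phi>' x" for x y
    using arg_cong[OF assms(1), of "\<lambda>a. a $ (x, y)"] by (simp only: smash_nth)
  show "u = u'" using nth[of u 0] assms(2) by (cases "u = u'") auto
  with nth[of u] show "\<phi> = \<phi>'" by auto
qed

lemma psi_of_inject:
  fixes lam :: "'g::{group_add,finite} \<Rightarrow> 'h::{group_add,finite} \<Rightarrow> 'k::field"
  assumes c: "compatible_quadruple lam \<omega> \<theta> v" and c': "compatible_quadruple lam' \<omega>' \<theta>' v'"
    and eq: "psi_of lam \<omega> \<theta> v = psi_of lam' \<omega>' \<theta>' v'"
  shows "lam = lam' \<and> \<omega> = \<omega>' \<and> \<theta> = \<theta>' \<and> v = v'"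
proof -
  have basis: "dual_image \<theta> lam g \<odot> smash (\<omega> s) (v s) = dual_image \<theta>' lam' g \<odot> smash (\<omega>' s) (v' s)" for g s
    unfolding psi_of_dbasis[symmetric] eq ..
  note r = double_relations_recover[OF compatible_double_relations[OF c]]
    and r' = double_relations_recover[OF compatible_double_relations[OF c']]
  have a: "dual_image \<theta> lam g = dual_image \<theta>' lam' g" for g
    by (subst r(1), subst r'(1)) (rule basis)
  have K: "smash (\<omega> s) (v s) = smash (\<omega>' s) (v' s)" for s
    by (subst r(2), subst r'(2)) (simp only: basis)
  have "lam g z = lam' g z" for g z
    by (subst quadruple_recover(1)[OF c], subst quadruple_recover(1)[OF c']) (simp only: a)
  moreover have "\<theta> w g = \<theta>' w g" for w g
    by (subst quadruple_recover(2)[OF c], subst quadruple_recover(2)[OF c']) (simp only: a)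
  moreover have "\<omega> s = \<omega>' s" "v s = v' s" for s
    using smash_eqD[OF K quadruple_recover(3)[OF c]] by blast+
  ultimately show ?thesis by (simp add: fun_eq_iff)
qed

lemma hopf_morphism_psi_of:
  assumes "compatible_quadruple lam \<omega> \<theta> v"
  shows "hopf_morphism drinfeld_double drinfeld_double (psi_of lam \<omega> \<theta> v)"
  using linear_psi_of compatible_double_relations[OF assms]
  by (rule double_relations_morphism) (rule psi_of_dbasis)

lemma hopf_morphism_is_psi_of:
  fixes \<psi> :: "'k::field ^ ('g::{group_add,finite} \<times> 'g) \<Rightarrow> 'k ^ ('h::{group_add,finite} \<times> 'h)"
  assumes \<psi>: "hopf_morphism drinfeld_double drinfeld_double \<psi>"
  obtains lam \<omega> \<theta> v where "compatible_quadruple lam \<omega> \<theta> v" "\<psi> = psi_of lam \<omega> \<theta> v"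
proof -
  obtain lam \<omega> \<theta> v where c: "compatible_quadruple lam \<omega> \<theta> v"
    and a: "(\<lambda>g. \<psi> (dbasis g 0)) = dual_image \<theta> lam"
    and K: "(\<lambda>s. \<psi> (smash (\<lambda>_. 1) s)) = (\<lambda>s. smash (\<omega> s) (v s))"
    by (rule double_relations_quadruple[OF morphism_double_relations(1)[OF \<psi>]])
  have "Vector_Spaces.linear (*s) (*s) \<psi>"
    using \<psi> unfolding hopf_morphism_def by blast
  moreover have "\<psi> (dbasis g s) = psi_of lam \<omega> \<theta> v (dbasis g s)" for g s
    using morphism_double_relations(2)[OF \<psi>, of g s] fun_cong[OF a, of g] fun_cong[OF K, of s]
    by (simp only: psi_of_dbasis)
  ultimately have "\<psi> x = psi_of lam \<omega> \<theta> v x" for x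
    by (rule linear_eqI_dbasis[OF _ linear_psi_of])
  then have "\<psi> = psi_of lam \<omega> \<theta> v" by (rule ext)
  with c show thesis by (rule that)
qed

theorem corollary2p4:
  shows "(\<forall>\<psi> :: 'k::field ^ ('g::{group_add,finite} \<times> 'g) \<Rightarrow> 'k ^ ('h::{group_add,finite} \<times> 'h).
           hopf_morphism drinfeld_double drinfeld_double \<psi> \<longrightarrow>
           (\<exists>lam \<omega> \<theta> v. compatible_quadruple lam \<omega> \<theta> v \<and>
             (\<forall>g g'. \<psi> (dbasis g g') =
               (\<Sum>x\<in>UNIV. \<Sum>y\<in>UNIV. \<Sum>z\<in>UNIV.
                 (lam (g - x) z * \<omega> g' y) *s
                   smash (\<lambda>w. \<theta> w x * of_bool (w = z + y - z)) (z + v g'))))) \<and>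
         bij_betw (\<lambda>(lam, \<omega>, \<theta>, v). psi_of lam \<omega> \<theta> v)
           {(lam, \<omega>, \<theta>, v). compatible_quadruple lam \<omega> \<theta> v}
           {\<psi> :: 'k ^ ('g \<times> 'g) \<Rightarrow> 'k ^ ('h \<times> 'h).
              hopf_morphism drinfeld_double drinfeld_double \<psi>}"
proof (intro conjI allI impI)
  fix \<psi> :: "'k ^ ('g \<times> 'g) \<Rightarrow> 'k ^ ('h \<times> 'h)"
  assume "hopf_morphism drinfeld_double drinfeld_double \<psi>"
  then obtain lam \<omega> \<theta> v where c: "compatible_quadruple lam \<omega> \<theta> v" and \<psi>: "\<psi> = psi_of lam \<omega> \<theta> v"
    by (rule hopf_morphism_is_psi_of)
  show "\<exists>lam \<omega> \<theta> v. compatible_quadruple lam \<omega> \<theta> v \<and>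
      (\<forall>g g'. \<psi> (dbasis g g') =
        (\<Sum>x\<in>UNIV. \<Sum>y\<in>UNIV. \<Sum>z\<in>UNIV.
          (lam (g - x) z * \<omega> g' y) *s
            smash (\<lambda>w. \<theta> w x * of_bool (w = z + y - z)) (z + v g')))"
    by (rule exI[of _ lam], rule exI[of _ \<omega>], rule exI[of _ \<theta>], rule exI[of _ v])
       (simp only: c \<psi> psi_of_dbasis psi_value simp_thms)
next
  show "bij_betw (\<lambda>(lam, \<omega>, \<theta>, v). psi_of lam \<omega> \<theta> v)
      {(lam, \<omega>, \<theta>, v). compatible_quadruple lam \<omega> \<theta> v}
      {\<psi> :: 'k ^ ('g \<times> 'g) \<Rightarrow> 'k ^ ('h \<times> 'h). hopf_morphism drinfeld_double drinfeld_double \<psi>}"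
    unfolding bij_betw_def
  proof (intro conjI subset_antisym subsetI)
    show "inj_on (\<lambda>(lam, \<omega>, \<theta>, v). psi_of lam \<omega> \<theta> v :: 'k ^ ('g \<times> 'g) \<Rightarrow> 'k ^ ('h \<times> 'h))
        {(lam, \<omega>, \<theta>, v). compatible_quadruple lam \<omega> \<theta> v}"
      by (rule inj_onI) (clarsimp, rule psi_of_inject)
  next
    fix \<psi> :: "'k ^ ('g \<times> 'g) \<Rightarrow> 'k ^ ('h \<times> 'h)"
    assume "\<psi> \<in> {\<psi>. hopf_morphism drinfeld_double drinfeld_double \<psi>}"
    then have "hopf_morphism drinfeld_double drinfeld_double \<psi>" by simp
    then obtain lam \<omega> \<theta> v where "compatible_quadruple lam \<omega> \<theta> v" "\<psi> = psi_of lam \<omega> \<theta> v"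
      by (rule hopf_morphism_is_psi_of)
    then show "\<psi> \<in> (\<lambda>(lam, \<omega>, \<theta>, v). psi_of lam \<omega> \<theta> v) ` {(lam, \<omega>, \<theta>, v). compatible_quadruple lam \<omega> \<theta> v}"
      by (intro image_eqI[where x="(lam, \<omega>, \<theta>, v)"]) simp_all
  next
    fix \<psi> :: "'k ^ ('g \<times> 'g) \<Rightarrow> 'k ^ ('h \<times> 'h)"
    assume "\<psi> \<in> (\<lambda>(lam, \<omega>, \<theta>, v). psi_of lam \<omega> \<theta> v) ` {(lam, \<omega>, \<theta>, v). compatible_quadruple lam \<omega> \<theta> v}"
    then show "\<psi> \<in> {\<psi>. hopf_morphism drinfeld_double drinfeld_double \<psi>}"
      by (clarsimp simp: hopf_morphism_psi_of)
  qed
qed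

end
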